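(* Let $S=(S_n)_{n\ge0}$ be an elephant random walk on $\mathbb{Z}$ with parameter $p\in[0,1]$, let $m$ be a positive integer, and let $\zeta_m:=\inf\{n\ge 0:|S_n|\ge m\}$. (i) If $p\le1/2$, then $S$ is recurrent and $\mathbb{E}\zeta_m\ge m^2$. Moreover, $$\limsup_{n\to\infty}\frac{|S_n|}{\sqrt{2n\log\log n}}\le1\ \text{ a.s.},\qquad \liminf_{n\to\infty}\sqrt{\pi n}\,\mathbb{P}(S_{2n}=0)\ge1 .$$ (ii) If $p\ge1/2$, then $\mathbb{E}\zeta_m\le m^2$ and $$\limsup_{n\to\infty}\frac{|S_n|}{\sqrt{2n\log\log n}}\ge1\ \text{ a.s.},\qquad \limsup_{n\to\infty}\sqrt{\pi n}\,\mathbb{P}(S_{2n}=0)\le1 .$$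
   Context: Elephant random walk (ERW) on $\mathbb{Z}$ with parameter $p\in[0,1]$: $S_0=0$, $S_1=\sigma_1=1$. For each $n\ge1$, choose $n'$ uniformly at random in $\{1,\dots,n\}$ (independently of the past); given the past and $n'$, let $\sigma_{n+1}=\sigma_{n'}$ with probability $p$ and $\sigma_{n+1}=-\sigma_{n'}$ with probability $1-p$. Set $S_{n+1}=S_n+\sigma_{n+1}$. A random walk $(S_n)$ on $\mathbb{Z}$ is called recurrent if for every $x\in\mathbb{Z}$, $\mathbb{P}(S_n=x\text{ for infinitely many }n)=1$. *)

theory Defs
  imports "HOL-Probability.Probability"
begin

text \<open>
  \<open>\<sigma> k\<close> is the \<open>k\<close>-th step (\<open>k \<ge> 1\<close>; \<open>\<sigma> 0\<close> is an irrelevant dummy), and \<open>mem n\<close> is the time in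
  \<open>{1..n}\<close> that the walk recalls in order to choose step \<open>n + 1\<close>.
  The past at time \<open>n\<close> is the vector of the steps \<open>\<sigma> 1, \<dots>, \<sigma> n\<close>.  Putting the earlier choices
  \<open>mem 1, \<dots>, mem (n - 1)\<close> into the past as well would only make the two assumptions
  on \<open>mem n\<close> and \<open>\<sigma> (n + 1)\<close> more restrictive, without changing the law of the walk.
\<close>

definition steps_upto :: "(nat \<Rightarrow> 'a \<Rightarrow> int) \<Rightarrow> nat \<Rightarrow> 'a \<Rightarrow> nat \<Rightarrow> int" where
  "steps_upto \<sigma> n \<omega> = (\<lambda>i\<in>{1..n}. \<sigma> i \<omega>)"

abbreviation step_space :: "nat \<Rightarrow> (nat \<Rightarrow> int) measure" where
  "step_space n \<equiv> PiM {1..n} (\<lambda>_. count_space UNIV)"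

definition past_and_choice ::
    "'a measure \<Rightarrow> (nat \<Rightarrow> 'a \<Rightarrow> int) \<Rightarrow> (nat \<Rightarrow> 'a \<Rightarrow> nat) \<Rightarrow> nat \<Rightarrow> 'a measure" where
  "past_and_choice M \<sigma> mem n =
     vimage_algebra (space M) (\<lambda>\<omega>. (steps_upto \<sigma> n \<omega>, mem n \<omega>))
       (step_space n \<Otimes>\<^sub>M count_space UNIV)"

locale elephant_random_walk = prob_space M
  for M :: "'a measure" and p :: real
    and \<sigma> :: "nat \<Rightarrow> 'a \<Rightarrow> int" and mem :: "nat \<Rightarrow> 'a \<Rightarrow> nat" and S :: "nat \<Rightarrow> 'a \<Rightarrow> int" +
  assumes p_range: "0 \<le> p" "p \<le> 1"
    and step_measurable: "\<And>n. \<sigma> n \<in> measurable M (count_space UNIV)"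
    and mem_measurable: "\<And>n. n \<ge> 1 \<Longrightarrow> mem n \<in> measurable M (count_space UNIV)"
    and S_0: "\<And>\<omega>. \<omega> \<in> space M \<Longrightarrow> S 0 \<omega> = 0"
    and S_Suc: "\<And>n \<omega>. \<omega> \<in> space M \<Longrightarrow> S (Suc n) \<omega> = S n \<omega> + \<sigma> (Suc n) \<omega>"
    and first_step: "AE \<omega> in M. \<sigma> 1 \<omega> = 1"
    and mem_uniform: "\<And>n. n \<ge> 1 \<Longrightarrow>
      distr M (count_space UNIV) (mem n) = measure_pmf (pmf_of_set {1..n})"
    and mem_indep: "\<And>n. n \<ge> 1 \<Longrightarrow>
      indep_set (sets (vimage_algebra (space M) (steps_upto \<sigma> n) (step_space n)))
                (sets (vimage_algebra (space M) (mem n) (count_space UNIV)))"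
    and step_repeat: "\<And>n. n \<ge> 1 \<Longrightarrow>
      AE \<omega> in M. real_cond_exp M (past_and_choice M \<sigma> mem n)
        (indicator {\<omega> \<in> space M. \<sigma> (n + 1) \<omega> = \<sigma> (mem n \<omega>) \<omega>}) \<omega> = p"
    and step_flip: "\<And>n. n \<ge> 1 \<Longrightarrow>
      AE \<omega> in M. real_cond_exp M (past_and_choice M \<sigma> mem n)
        (indicator {\<omega> \<in> space M. \<sigma> (n + 1) \<omega> = - \<sigma> (mem n \<omega>) \<omega>}) \<omega> = 1 - p"

definition recurrent :: "'a measure \<Rightarrow> (nat \<Rightarrow> 'a \<Rightarrow> int) \<Rightarrow> bool" where
  "recurrent M S \<longleftrightarrow> (\<forall>x. \<P>(\<omega> in M. \<exists>\<^sub>\<infinity>n. S n \<omega> = x) = 1)"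

text \<open>The infimum is taken in \<open>enat\<close>, so the exit time is \<open>\<infinity>\<close> if the walk never leaves.\<close>

definition exit_time :: "(nat \<Rightarrow> 'a \<Rightarrow> int) \<Rightarrow> nat \<Rightarrow> 'a \<Rightarrow> enat" where
  "exit_time S m \<omega> = Inf (enat ` {n. \<bar>S n \<omega>\<bar> \<ge> int m})"

definition expected_exit_time :: "'a measure \<Rightarrow> (nat \<Rightarrow> 'a \<Rightarrow> int) \<Rightarrow> nat \<Rightarrow> ennreal" where
  "expected_exit_time M S m = (\<integral>\<^sup>+ \<omega>. ennreal_of_enat (exit_time S m \<omega>) \<partial>M)"

end

theory Submission
  imports Defs "HOL-Real_Asymp.Real_Asymp"
begin

text \<open>
Given the first \<open>n\<close> steps, the elephant repeats or flips a uniformly chosen one of them.  Of these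
steps \<open>(n + S\<^sub>n) / 2\<close> point upwards, so \<open>S\<close> moves up with probability \<open>(1 + (2p - 1) S\<^sub>n / n) / 2\<close>:
it is a simple random walk with an extra drift that points towards the origin if \<open>p \<le> 1/2\<close> and
away from it if \<open>p \<ge> 1/2\<close>.  Every claim compares \<open>S\<close> with the simple random walk.
The proofs rest on three facts about the law of \<open>S\<close>: the first step leads to \<open>1\<close>, all steps
have size one (\<open>S_path\<close>), and the one-step identity \<open>markov_step\<close>.

The one-time comparison is \<open>srw_domination\<close>.  An even function \<open>f\<close> of the position that increases
along \<open>k, k + 2, k + 4, \<dots>\<close> for \<open>k \<ge> 0\<close> gains from an outward drift, and one step of the simple
walk preserves this monotonicity.  Iterating, the expectation of \<open>f (S\<^sub>n\<^sub>+\<^sub>j)\<close> given the past is at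
least, respectively at most, that for a simple walk started at \<open>S\<^sub>n\<close>.  With \<open>f\<close> the
indicator of the origin, this bounds \<open>P(S\<^sub>2\<^sub>n = 0)\<close> by a central binomial probability, whose
asymptotics are Wallis' product.

Exit times: \<open>S\<^sub>n\<^sup>2 - n\<close> is a supermartingale for \<open>p \<le> 1/2\<close> and a submartingale for \<open>p \<ge> 1/2\<close>, and
the walk leaves the strip of half-width \<open>m\<close> exactly at height \<open>m\<close> (\<open>stopped_square_bound\<close>).

Recurrence for \<open>p \<le> 1/2\<close>: let \<open>\<alpha>\<close> bound the conditional probability of never visiting \<open>x\<close> again, at
all late times and for all pasts.  From the origin the walk goes straight to \<open>x\<close> with probability at
least \<open>4\<^sup>-\<^sup>|\<^sup>x\<^sup>|\<close>, and the inward drift makes it reach the origin at least as surely as the simple walk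
does, that is, almost surely.  So \<open>\<alpha> (1 - 4\<^sup>-\<^sup>|\<^sup>x\<^sup>|)\<close> is a bound as well (\<open>avoidance_bound_contract\<close>),
and iterating it shows that the probability is \<open>0\<close>.

Law of the iterated logarithm: for \<open>p \<le> 1/2\<close> the process \<open>cosh (\<lambda> S\<^sub>n) / (cosh \<lambda>)\<^sup>n\<close> is a
supermartingale, which gives the Gaussian bound \<open>maximal_inequality\<close> and then, by the Borel-Cantelli
lemma along geometric times, the upper bound.  For \<open>p \<ge> 1/2\<close>, whatever happened before,
domination makes \<open>|S|\<close> at least as likely to be large at the end of a block of times as the absolute
value of a simple walk that starts the block at \<open>0\<close>.  For geometric blocks a Gaussian lower
bound on binomial coefficients makes these probabilities non-summable, hence the level is exceeded
at infinitely many block ends (\<open>infinitely_often_far\<close>).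
\<close>

section \<open>One-step operators of the simple and of the elephant random walk\<close>

definition srw_op :: "(int \<Rightarrow> real) \<Rightarrow> int \<Rightarrow> real" where
  "srw_op f s = (f (s + 1) + f (s - 1)) / 2"

text \<open>
The mean of \<open>f\<close> after one step of the elephant from position \<open>s\<close> at time \<open>n\<close>, that is, for up and
down probabilities \<open>(1 \<plusminus> (2 p - 1) s / n) / 2\<close>, written as the simple random walk plus the drift.
\<close>

definition erw_op :: "real \<Rightarrow> nat \<Rightarrow> (int \<Rightarrow> real) \<Rightarrow> int \<Rightarrow> real" where
  "erw_op p n f s = srw_op f s + (2 * p - 1) * s / (2 * n) * (f (s + 1) - f (s - 1))"

lemma erw_op_affine: "erw_op p n (\<lambda>s. a + b * f s) s = a + b * erw_op p n f s"
proof -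
  have "srw_op (\<lambda>s. a + b * f s) s = a + b * srw_op f s"
    by (simp add: srw_op_def add_divide_distrib distrib_left)
  moreover have "(a + b * f (s + 1)) - (a + b * f (s - 1)) = b * (f (s + 1) - f (s - 1))"
    by (simp add: right_diff_distrib)
  ultimately show ?thesis by (simp only: erw_op_def) (simp add: distrib_left)
qed

text \<open>
For \<open>c > 0\<close> this says that \<open>f\<close> is even and increases away from the origin along each parity class,
and for \<open>c < 0\<close> that it is even and decreases.  The jumps by \<open>2\<close> reflect the periodicity of the
walk: monotonicity in \<open>|s|\<close> across the two parity classes is not preserved by a step.
The factor \<open>c\<close> will be the drift \<open>2 p - 1\<close>, so that both regimes are treated at once.
\<close>

definition radially_monotone :: "real \<Rightarrow> (int \<Rightarrow> real) \<Rightarrow> bool" where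
  "radially_monotone c f \<longleftrightarrow> (\<forall>s. f (- s) = f s) \<and> (\<forall>k\<ge>0. 0 \<le> c * (f (k + 2) - f k))"

text \<open>
A step averages the increments at \<open>k - 1\<close> and \<open>k + 1\<close>; at \<open>k = 0\<close> the first one is
\<open>f 1 - f (- 1) = 0\<close> by symmetry.
\<close>

lemma srw_op_radially_monotone:
  assumes "radially_monotone c f"
  shows "radially_monotone c (srw_op f)"
  unfolding radially_monotone_def
proof (intro conjI allI impI)
  have even: "f (- s) = f s" for s using assms by (simp add: radially_monotone_def)
  fix s :: int
  show "srw_op f (- s) = srw_op f s"
    using even[of "s + 1"] even[of "s - 1"] by (simp add: srw_op_def)
next
  have even: "f (- s) = f s" for s using assms by (simp add: radially_monotone_def)
  have mono: "0 \<le> c * (f (k + 2) - f k)" if "k \<ge> 0" for k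
    using that assms by (simp add: radially_monotone_def)
  fix k :: int assume k: "0 \<le> k"
  have "0 \<le> c * (f (k + 1) - f (k - 1))"
    using mono[of "k - 1"] k even[of 1] by (cases "k = 0") (auto simp: add.commute)
  moreover have "0 \<le> c * (f (k + 3) - f (k + 1))"
    using mono[of "k + 1"] k by (simp add: algebra_simps)
  ultimately have "0 \<le> (c * (f (k + 1) - f (k - 1)) + c * (f (k + 3) - f (k + 1))) / 2"
    by simp
  also have "\<dots> = c * (srw_op f (k + 2) - srw_op f k)"
    by (simp add: srw_op_def field_simps)
  finally show "0 \<le> c * (srw_op f (k + 2) - srw_op f k)" .
qed

lemma srw_op_iter_radially_monotone:
  "radially_monotone c f \<Longrightarrow> radially_monotone c ((srw_op ^^ j) f)"
  by (induction j) (auto intro: srw_op_radially_monotone)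

text \<open>
The drift at \<open>s\<close> has the sign of \<open>(2 p - 1) s\<close>, and \<open>(2 p - 1) (f (s + 1) - f (s - 1))\<close> has the
sign of \<open>s\<close>, so their product is nonnegative.
\<close>

lemma srw_op_le_erw_op:
  assumes "radially_monotone (2 * p - 1) f"
  shows "srw_op f s \<le> erw_op p n f s"
proof -
  have even: "f (- s) = f s" for s using assms by (simp add: radially_monotone_def)
  have mono: "0 \<le> (2 * p - 1) * (f (k + 2) - f k)" if "k \<ge> 0" for k
    using that assms by (simp add: radially_monotone_def)
  have "0 \<le> real_of_int s * ((2 * p - 1) * (f (s + 1) - f (s - 1)))"
  proof (cases "s \<ge> 1")
    case True
    then have "0 \<le> (2 * p - 1) * (f (s + 1) - f (s - 1))" using mono[of "s - 1"] by (simp add: add.commute)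
    then show ?thesis by (rule mult_nonneg_nonneg[rotated]) (use True in simp)
  next
    case False
    then consider "s = 0" | "s \<le> -1" by linarith
    then show ?thesis
    proof cases
      case 2
      have "0 \<le> (2 * p - 1) * (f (s - 1) - f (s + 1))"
        using mono[of "- (s + 1)"] even[of "s - 1"] even[of "s + 1"] 2 by simp
      then have "0 \<le> real_of_int (- s) * ((2 * p - 1) * (f (s - 1) - f (s + 1)))"
        by (rule mult_nonneg_nonneg[rotated]) (use 2 in simp)
      then show ?thesis by (simp add: algebra_simps)
    qed simp
  qed
  then have "0 \<le> real_of_int s * ((2 * p - 1) * (f (s + 1) - f (s - 1))) / (2 * real n)"
    by simp
  then show ?thesis
    unfolding erw_op_def by (simp add: field_simps)
qed

lemma radially_monotone_even_ge_0:
  assumes f: "radially_monotone 1 f" and s: "even s"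
  shows "f 0 \<le> f s"
proof -
  have "f 0 \<le> f (2 * int k)" for k
  proof (induction k)
    case (Suc k)
    have "f (2 * int k) \<le> f (2 * int k + 2)" using f by (simp add: radially_monotone_def)
    then show ?case using Suc.IH by (simp add: algebra_simps)
  qed simp
  from this[of "nat (\<bar>s\<bar> div 2)"] have "f 0 \<le> f \<bar>s\<bar>" using s by simp
  moreover have "f \<bar>s\<bar> = f s" using f by (auto simp: radially_monotone_def abs_if)
  ultimately show ?thesis by simp
qed

lemma erw_op_le_srw_op:
  assumes p: "p \<le> 1/2" and f: "radially_monotone 1 f"
  shows "erw_op p n f s \<le> srw_op f s"
proof -
  have "radially_monotone (2 * p - 1) (\<lambda>s. - f s)"
    unfolding radially_monotone_def
  proof (intro conjI allI impI)
    fix k :: int assume "0 \<le> k"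
    then have "0 \<le> f (k + 2) - f k" using f by (simp add: radially_monotone_def)
    then have "0 \<le> (1 - 2 * p) * (f (k + 2) - f k)" using p by simp
    then show "0 \<le> (2 * p - 1) * (- f (k + 2) - - f k)" by (simp add: algebra_simps)
  qed (use f in \<open>simp add: radially_monotone_def\<close>)
  from srw_op_le_erw_op[OF this, of s n]
  show ?thesis
    using erw_op_affine[of p n 0 "-1" f s] by (simp add: srw_op_def)
qed

section \<open>The elephant random walk as a Markov chain\<close>

context elephant_random_walk
begin

text \<open>
Being a function of the first \<open>n\<close> steps, stated pointwise.  As there are only countably many step
sequences, measurability with respect to the past is automatic, and closure under
arbitrary operations is immediate.
\<close>

definition adapted :: "nat \<Rightarrow> ('a \<Rightarrow> 'b) \<Rightarrow> bool" where
  "adapted n g \<longleftrightarrow> (\<forall>\<omega>\<in>space M. \<forall>\<omega>'\<in>space M.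
     (\<forall>i\<in>{1..n}. \<sigma> i \<omega> = \<sigma> i \<omega>') \<longrightarrow> g \<omega> = g \<omega>')"

lemma adaptedI:
  assumes "\<And>\<omega> \<omega>'. \<omega> \<in> space M \<Longrightarrow> \<omega>' \<in> space M \<Longrightarrow> (\<And>i. 1 \<le> i \<Longrightarrow> i \<le> n \<Longrightarrow> \<sigma> i \<omega> = \<sigma> i \<omega>') \<Longrightarrow> g \<omega> = g \<omega>'"
  shows "adapted n g"
  unfolding adapted_def by (intro ballI impI, rule assms) simp_all

lemma adaptedD:
  assumes "adapted n g" "\<omega> \<in> space M" "\<omega>' \<in> space M" "\<And>i. 1 \<le> i \<Longrightarrow> i \<le> n \<Longrightarrow> \<sigma> i \<omega> = \<sigma> i \<omega>'"
  shows "g \<omega> = g \<omega>'"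
  using assms(1)[unfolded adapted_def, rule_format, OF assms(2,3)] assms(4) by simp

lemma adapted_mono: "adapted n g \<Longrightarrow> n \<le> m \<Longrightarrow> adapted m g"
  by (rule adaptedI, erule adaptedD) auto

lemma adapted_const [intro, simp]: "adapted n (\<lambda>_. c)"
  by (rule adaptedI) auto

lemma adapted_cong: "adapted n g \<Longrightarrow> (\<And>\<omega>. \<omega> \<in> space M \<Longrightarrow> h \<omega> = g \<omega>) \<Longrightarrow> adapted n h"
  unfolding adapted_def by metis

lemma adapted_comp: "adapted n g \<Longrightarrow> adapted n (\<lambda>\<omega>. f (g \<omega>))"
  unfolding adapted_def by metis

lemma adapted_comp2: "adapted n g \<Longrightarrow> adapted n h \<Longrightarrow> adapted n (\<lambda>\<omega>. f (g \<omega>) (h \<omega>))"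
  unfolding adapted_def by metis

lemma adapted_step: "1 \<le> i \<Longrightarrow> i \<le> n \<Longrightarrow> adapted n (\<sigma> i)"
  by (rule adaptedI) auto

lemma adapted_S: "k \<le> n \<Longrightarrow> adapted n (S k)"
proof (induction k)
  case 0
  then show ?case by (auto intro!: adaptedI simp: S_0)
next
  case (Suc k)
  then have "adapted n (S k)" by simp
  then have "adapted n (\<lambda>\<omega>. S k \<omega> + \<sigma> (Suc k) \<omega>)"
    by (rule adapted_comp2) (use Suc.prems in \<open>intro adapted_step; simp\<close>)
  then show ?case by (rule adapted_cong) (rule S_Suc)
qed

lemma adapted_all: "(\<And>i. i \<in> I \<Longrightarrow> adapted n (P i)) \<Longrightarrow> adapted n (\<lambda>\<omega>. \<forall>i\<in>I. P i \<omega>)"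
  unfolding adapted_def by metis

lemma steps_upto_eq_iff: "steps_upto \<sigma> n \<omega> = steps_upto \<sigma> n \<omega>' \<longleftrightarrow> (\<forall>i\<in>{1..n}. \<sigma> i \<omega> = \<sigma> i \<omega>')"
  unfolding steps_upto_def by (auto simp: restrict_def fun_eq_iff)

lemma adapted_factor:
  assumes "adapted n g"
  shows "\<exists>h. \<forall>\<omega>\<in>space M. g \<omega> = h (steps_upto \<sigma> n \<omega>)"
proof (intro exI ballI)
  fix \<omega> assume w: "\<omega> \<in> space M"
  define \<omega>' where "\<omega>' = (SOME \<omega>'. \<omega>' \<in> space M \<and> steps_upto \<sigma> n \<omega>' = steps_upto \<sigma> n \<omega>)"
  have "\<omega>' \<in> space M \<and> steps_upto \<sigma> n \<omega>' = steps_upto \<sigma> n \<omega>"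
    unfolding \<omega>'_def by (rule someI[of _ \<omega>]) (use w in auto)
  then have "g \<omega>' = g \<omega>"
    using assms w unfolding adapted_def steps_upto_eq_iff by blast
  then show "g \<omega> = (\<lambda>e. g (SOME \<omega>'. \<omega>' \<in> space M \<and> steps_upto \<sigma> n \<omega>' = e)) (steps_upto \<sigma> n \<omega>)"
    unfolding \<omega>'_def by simp
qed

lemma step_space_eq: "step_space n = count_space (PiE {1..n} (\<lambda>_. UNIV))"
  by (rule count_space_PiM_finite) auto

lemma steps_upto_measurable: "steps_upto \<sigma> n \<in> measurable M (step_space n)"
  unfolding steps_upto_def by (intro measurable_restrict step_measurable)

lemma measurable_step_space: "h \<in> borel_measurable (step_space n)"
  unfolding step_space_eq by simp

lemma adapted_measurable_past:
  fixes g :: "'a \<Rightarrow> real"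
  assumes "adapted n g"
  shows "g \<in> borel_measurable (vimage_algebra (space M) (steps_upto \<sigma> n) (step_space n))"
      (is "_ \<in> measurable ?F _")
proof -
  obtain h where h: "\<And>\<omega>. \<omega> \<in> space M \<Longrightarrow> g \<omega> = h (steps_upto \<sigma> n \<omega>)"
    using adapted_factor[OF assms] by blast
  have "steps_upto \<sigma> n \<in> measurable ?F (step_space n)"
    by (rule measurable_vimage_algebra1) (use measurable_space[OF steps_upto_measurable] in auto)
  then have "(\<lambda>\<omega>. h (steps_upto \<sigma> n \<omega>)) \<in> borel_measurable ?F"
    by (rule measurable_compose) (rule measurable_step_space)
  then show ?thesis
    by (subst measurable_cong[of _ _ "\<lambda>\<omega>. h (steps_upto \<sigma> n \<omega>)"]) (auto simp: h)
qed

lemma adapted_borel_measurable: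
  fixes g :: "'a \<Rightarrow> real"
  assumes "adapted n g"
  shows "g \<in> borel_measurable M"
proof -
  obtain h where h: "\<And>\<omega>. \<omega> \<in> space M \<Longrightarrow> g \<omega> = h (steps_upto \<sigma> n \<omega>)"
    using adapted_factor[OF assms] by blast
  have "(\<lambda>\<omega>. h (steps_upto \<sigma> n \<omega>)) \<in> borel_measurable M"
    by (rule measurable_compose[OF steps_upto_measurable measurable_step_space])
  then show ?thesis
    by (subst measurable_cong[of _ _ "\<lambda>\<omega>. h (steps_upto \<sigma> n \<omega>)"]) (auto simp: h)
qed

lemma mem_indicator_mult_measurable:
  fixes g :: "'a \<Rightarrow> real"
  assumes "adapted n g" "n \<ge> 1"
  shows "(\<lambda>\<omega>. g \<omega> * of_bool (mem n \<omega>
      = j)) \<in> borel_measurable (past_and_choice M \<sigma> mem n)" (is "_ \<in> measurable ?F _")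
proof -
  obtain h where h: "\<And>\<omega>. \<omega> \<in> space M \<Longrightarrow> g \<omega> = h (steps_upto \<sigma> n \<omega>)"
    using adapted_factor[OF assms(1)] by blast
  have 1: "(\<lambda>\<omega>. (steps_upto \<sigma> n \<omega>, mem n \<omega>)) \<in> measurable ?F (step_space n \<Otimes>\<^sub>M count_space UNIV)"
    unfolding past_and_choice_def
    by (rule measurable_vimage_algebra1)
       (use measurable_space[OF steps_upto_measurable] in \<open>auto simp: space_pair_measure\<close>)
  have 2: "(\<lambda>x. h (fst x) * of_bool (snd x = j)) \<in> borel_measurable (step_space n \<Otimes>\<^sub>M count_space UNIV)"
    by (intro borel_measurable_times measurable_compose[OF measurable_fst measurable_step_space]
        measurable_compose[OF measurable_snd, of "\<lambda>i. of_bool (i = j)"]) auto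
  have sp: "space ?F = space M"
    by (simp add: past_and_choice_def)
  have "(\<lambda>\<omega>. g \<omega> * of_bool (mem n \<omega> = j)) \<in> borel_measurable ?F \<longleftrightarrow> 
     (\<lambda>\<omega>. h (steps_upto \<sigma> n \<omega>) * of_bool (mem n \<omega> = j)) \<in> borel_measurable ?F"
    by (rule measurable_cong) (auto simp: sp h)
  with measurable_compose[OF 1 2] show ?thesis by simp
qed

lemma past_and_choice_subalgebra:
  assumes "n \<ge> 1" shows "sigma_finite_subalgebra M (past_and_choice M \<sigma> mem n)"
proof -
  have *: "(\<lambda>\<omega>. (steps_upto \<sigma> n \<omega>, mem n \<omega>)) \<in> measurable M (step_space n \<Otimes>\<^sub>M count_space UNIV)"
    by (intro measurable_Pair steps_upto_measurable mem_measurable assms)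
  have "subalgebra M (past_and_choice M \<sigma> mem n)"
    unfolding subalgebra_def past_and_choice_def
    using sets_image_in_sets[OF refl *] by auto
  then have "finite_measure_subalgebra M (past_and_choice M \<sigma> mem n)"
    by unfold_locales
  then show ?thesis by (rule finite_measure_subalgebra_is_sigma_finite)
qed

lemma step_event [measurable]: "Measurable.pred M (\<lambda>\<omega>. \<sigma> n \<omega> = c)"
  using step_measurable[of n] by measurable

lemma mem_event [measurable]: "n \<ge> 1 \<Longrightarrow> Measurable.pred M (\<lambda>\<omega>. mem n \<omega> = j)"
  using mem_measurable[of n] by measurable

lemma repeat_event [measurable]:
  assumes "n \<ge> 1" shows "Measurable.pred M (\<lambda>\<omega>. \<sigma> m \<omega> = \<sigma> (mem n \<omega>) \<omega>)"
proof -
  have "Measurable.pred M (\<lambda>\<omega>. \<exists>j c. mem n \<omega> = j \<and> \<sigma> j \<omega> = c \<and> \<sigma> m \<omega> = c)"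
    using assms by measurable
  then show ?thesis by simp
qed

lemma flip_event [measurable]:
  assumes "n \<ge> 1" shows "Measurable.pred M (\<lambda>\<omega>. \<sigma> m \<omega> = - \<sigma> (mem n \<omega>) \<omega>)"
proof -
  have "Measurable.pred M (\<lambda>\<omega>. \<exists>j c. mem n \<omega> = j \<and> \<sigma> j \<omega> = c \<and> \<sigma> m \<omega> = -c)"
    using assms by measurable
  then show ?thesis by simp
qed

lemma mem_range: assumes "n \<ge> 1" shows "AE \<omega> in M. 1 \<le> mem n \<omega> \<and> mem n \<omega> \<le> n"
proof -
  have "AE j in distr M (count_space UNIV) (mem n). j \<in> {1..n}"
    unfolding mem_uniform[OF assms] using assms by (auto simp: AE_measure_pmf_iff)
  then show ?thesis
    by (subst (asm) AE_distr_iff) (use mem_measurable[OF assms] in auto)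
qed

lemma mem_prob: assumes "j \<in> {1..n}" shows "\<P>(\<omega> in M. mem n \<omega> = j) = 1 / n"
proof -
  have n: "n \<ge> 1" using assms by simp
  have "\<P>(\<omega> in M. mem n \<omega> = j) = measure (distr M (count_space UNIV) (mem n)) {j}"
    by (subst measure_distr) (use mem_measurable[OF n] in \<open>auto simp: vimage_def Int_def conj_commute\<close>)
  also have "\<dots> = 1 / n"
    unfolding mem_uniform[OF n] using assms by (simp add: measure_pmf_of_set)
  finally show ?thesis .
qed

lemma repeat_flip:
  assumes "n \<ge> 1"
    and F: "F \<in> borel_measurable (past_and_choice M \<sigma> mem n)" "integrable M F"
  shows "(\<integral>\<omega>. F \<omega> * of_bool (\<sigma> (Suc n) \<omega> = \<sigma> (mem n \<omega>) \<omega>) \<partial>M) = p * (\<integral>\<omega>. F \<omega> \<partial>M)"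
    and "(\<integral>\<omega>. F \<omega> * of_bool (\<sigma> (Suc n) \<omega> = - \<sigma> (mem n \<omega>) \<omega>) \<partial>M) = (1 - p) * (\<integral>\<omega>. F \<omega> \<partial>M)"
proof -
  interpret sigma_finite_subalgebra M "past_and_choice M \<sigma> mem n"
    by (rule past_and_choice_subalgebra[OF assms(1)])
  have gen: "(\<integral>\<omega>. F \<omega> * of_bool (P \<omega>) \<partial>M) = q * (\<integral>\<omega>. F \<omega> \<partial>M)"
    if P[measurable]: "Measurable.pred M P" and q: "AE \<omega> in M. real_cond_exp M (past_and_choice M \<sigma> mem n)
        (indicator {\<omega> \<in> space M. P \<omega>}) \<omega> = q" for P q
  proof -
    have FM[measurable]: "F \<in> borel_measurable M" using F(2) by auto
    have "(\<integral>\<omega>. F \<omega> * of_bool (P \<omega>) \<partial>M) = (\<integral>\<omega>. F \<omega> * indicator {\<omega> \<in> space M. P \<omega>} \<omega> \<partial>M)"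
      by (intro Bochner_Integration.integral_cong) auto
    also have "\<dots> = (\<integral>\<omega>. F \<omega> * real_cond_exp M (past_and_choice M \<sigma> mem n) (indicator {\<omega> \<in> space M. P \<omega>}) \<omega>
        \<partial>M)"
      by (intro real_cond_exp_intg(2)[symmetric] F integrable_real_mult_indicator) auto
    also have "\<dots> = (\<integral>\<omega>. F \<omega> * q \<partial>M)"
      by (rule integral_cong_AE) (use q in auto)
    finally show ?thesis by (simp add: mult.commute)
  qed
  show "(\<integral>\<omega>. F \<omega> * of_bool (\<sigma> (Suc n) \<omega> = \<sigma> (mem n \<omega>) \<omega>) \<partial>M) = p * (\<integral>\<omega>. F \<omega> \<partial>M)"
    by (rule gen) (use step_repeat[OF assms(1)] assms(1) in auto)
  show "(\<integral>\<omega>. F \<omega> * of_bool (\<sigma> (Suc n) \<omega> = - \<sigma> (mem n \<omega>) \<omega>) \<partial>M) = (1 - p) * (\<integral>\<omega>. F \<omega> \<partial>M)"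
    by (rule gen) (use step_flip[OF assms(1)] assms(1) in auto)
qed

text \<open>
The recalled step is nonzero by induction, so repeating it and flipping it are disjoint events;
their probabilities \<open>p\<close> and \<open>1 - p\<close> add up to \<open>1\<close>.
\<close>

lemma steps_pm1: "AE \<omega> in M. \<forall>i\<in>{1..n}. \<sigma> i \<omega> = 1 \<or> \<sigma> i \<omega> = -1"
proof (induction n)
  case 0 show ?case by simp
next
  case (Suc n)
  show ?case
  proof (cases "n = 0")
    case True
    then show ?thesis using first_step by auto
  next
    case False
    then have n: "n \<ge> 1" by simp
    have mz: "AE \<omega> in M. \<sigma> (mem n \<omega>) \<omega> = 1 \<or> \<sigma> (mem n \<omega>) \<omega> = -1"
      using Suc.IH mem_range[OF n] by eventually_elim auto
    let ?R = "\<lambda>\<omega>. of_bool (\<sigma> (Suc n) \<omega> = \<sigma> (mem n \<omega>) \<omega>) :: real"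
    let ?F = "\<lambda>\<omega>. of_bool (\<sigma> (Suc n) \<omega> = - \<sigma> (mem n \<omega>) \<omega>) :: real"
    have [measurable]: "Measurable.pred M (\<lambda>\<omega>. \<sigma> (Suc n) \<omega> = \<sigma> (mem n \<omega>) \<omega>)"
      "Measurable.pred M (\<lambda>\<omega>. \<sigma> (Suc n) \<omega> = - \<sigma> (mem n \<omega>) \<omega>)"
      using n by auto
    have int: "integrable M ?R" "integrable M ?F"
      by (rule integrable_const_bound[of _ 1], simp, measurable)+
    have "(\<integral>\<omega>. ?R \<omega> + ?F \<omega> \<partial>M) = p + (1 - p)"
    proof -
      have "(\<integral>\<omega>. ?R \<omega> + ?F \<omega> \<partial>M) = (\<integral>\<omega>. ?R \<omega> \<partial>M) + (\<integral>\<omega>. ?F \<omega> \<partial>M)"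
        by (rule Bochner_Integration.integral_add[OF int])
      moreover have "(\<integral>\<omega>. 1 * ?R \<omega> \<partial>M) = p * (\<integral>\<omega>. 1 \<partial>M)" "(\<integral>\<omega>. 1 * ?F \<omega> \<partial>M) = (1 - p) * (\<integral>\<omega>. 1 \<partial>M)"
        by (rule repeat_flip[OF n]; simp)+
      ultimately show ?thesis by (simp only: mult_1 prob_space lebesgue_integral_const) simp
    qed
    moreover have "(\<integral>\<omega>. 1 - (?R \<omega> + ?F \<omega>) \<partial>M) = 1 - (\<integral>\<omega>. ?R \<omega> + ?F \<omega> \<partial>M)"
      by (subst Bochner_Integration.integral_diff)
         (use Bochner_Integration.integrable_add[OF int] in \<open>simp_all only: lebesgue_integral_const
             prob_space integrable_const, simp\<close>)
    ultimately have "(\<integral>\<omega>. 1 - (?R \<omega> + ?F \<omega>) \<partial>M) = 0"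
      by simp
    moreover have "AE \<omega> in M. 0 \<le> 1 - (?R \<omega> + ?F \<omega>)"
      using mz by eventually_elim auto
    moreover have "integrable M (\<lambda>\<omega>. 1 - (?R \<omega> + ?F \<omega>))"
      using int by auto
    ultimately have "AE \<omega> in M. 1 - (?R \<omega> + ?F \<omega>) = 0"
      using integral_nonneg_eq_0_iff_AE by blast
    with Suc.IH mz show ?thesis
      by eventually_elim (auto simp: of_bool_def le_Suc_eq split: if_splits)
  qed
qed

text \<open>
The first \<open>n\<close> steps almost surely take only \<open>2\<^sup>n\<close> values, so every function of them is bounded.
\<close>

lemma adapted_integrable:
  fixes g :: "'a \<Rightarrow> real"
  assumes "adapted n g"
  shows "integrable M g"
proof -
  obtain h where h: "\<And>\<omega>. \<omega> \<in> space M \<Longrightarrow> g \<omega> = h (steps_upto \<sigma> n \<omega>)"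
    using adapted_factor[OF assms] by blast
  let ?E = "PiE {1..n} (\<lambda>_. {1, -1::int})"
  have fin: "finite ?E" by (intro finite_PiE) auto
  have "AE \<omega> in M. norm (g \<omega>) \<le> Max ((\<lambda>e. \<bar>h e\<bar>) ` ?E)"
    using steps_pm1[of n] AE_space
  proof eventually_elim
    case (elim \<omega>)
    then have "steps_upto \<sigma> n \<omega> \<in> ?E"
      by (auto simp: steps_upto_def)
    then show ?case using fin elim by (simp add: h)
  qed
  then show ?thesis
    by (intro integrable_const_bound) (auto intro: adapted_borel_measurable[OF assms])
qed

lemma mem_indep_integral:
  fixes g :: "'a \<Rightarrow> real"
  assumes g: "adapted n g" and j: "j \<in> {1..n}"
  shows "(\<integral>\<omega>. g \<omega> * of_bool (mem n \<omega> = j) \<partial>M) = (1 / n) * (\<integral>\<omega>. g \<omega> \<partial>M)"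
proof -
  have n: "n \<ge> 1" using j by simp
  let ?J = "\<lambda>\<omega>. of_bool (mem n \<omega> = j) :: real"
  have gF: "g \<in> borel_measurable (vimage_algebra (space M) (steps_upto \<sigma> n) (step_space n))"
    by (rule adapted_measurable_past[OF g])
  have mF: "mem n \<in> measurable (vimage_algebra (space M) (mem n) (count_space UNIV)) (count_space UNIV)"
    by (rule measurable_vimage_algebra1) auto
  have JF: "?J \<in> borel_measurable (vimage_algebra (space M) (mem n) (count_space UNIV))"
    by (rule measurable_compose[OF mF]) auto
  have [measurable]: "Measurable.pred M (\<lambda>\<omega>. mem n \<omega> = j)" using n by auto
  have "indep_var borel g borel ?J"
    unfolding indep_var_eq
  proof (intro conjI)
    show "random_variable borel g" by (rule adapted_borel_measurable[OF g])
    show "random_variable borel ?J" by measurable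
    show "indep_set (sigma_sets (space M) {g -` A \<inter> space M |A. A \<in> sets borel})
     (sigma_sets (space M) {?J -` A \<inter> space M |A. A \<in> sets borel})"
      using mem_indep[OF n] unfolding indep_set_def
    proof (rule indep_sets_mono_sets)
      fix i :: bool assume "i \<in> UNIV"
      have "sigma_sets (space M) {g -` A \<inter> space M |A. A \<in> sets borel} \<subseteq> sets
          (vimage_algebra (space M) (steps_upto \<sigma> n) (step_space n))"
        using sets_image_in_sets[OF _ gF, of "space M"] by (simp add: sets_vimage_algebra)
      moreover have "sigma_sets (space M) {?J -` A \<inter> space M |A. A \<in> sets borel} \<subseteq> sets
          (vimage_algebra (space M) (mem n) (count_space UNIV))"
        using sets_image_in_sets[OF _ JF, of "space M"] by (simp add: sets_vimage_algebra)
      ultimately show "case_bool (sigma_sets (space M) {g -` A \<inter> space M |A. A \<in> sets borel})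
          (sigma_sets (space M) {?J -` A \<inter> space M |A. A \<in> sets borel}) i
         \<subseteq> case_bool (sets (vimage_algebra (space M) (steps_upto \<sigma> n) (step_space n)))
             (sets (vimage_algebra (space M) (mem n) (count_space UNIV))) i"
        by (cases i) auto
    qed
  qed
  then have "(\<integral>\<omega>. g \<omega> * ?J \<omega> \<partial>M) = (\<integral>\<omega>. g \<omega> \<partial>M) * (\<integral>\<omega>. ?J \<omega> \<partial>M)"
    by (rule indep_var_lebesgue_integral)
       (auto intro!: adapted_integrable[OF g] integrable_const_bound[of _ 1])
  also have "(\<integral>\<omega>. ?J \<omega> \<partial>M) = \<P>(\<omega> in M. mem n \<omega> = j)"
  proof -
    have "(\<integral>\<omega>. ?J \<omega> \<partial>M) = (\<integral>\<omega>. indicator {\<omega> \<in> space M. mem n \<omega> = j} \<omega> \<partial>M)"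
      by (intro Bochner_Integration.integral_cong) auto
    then show ?thesis by simp
  qed
  also have "\<dots> = 1 / n" by (rule mem_prob[OF j])
  finally show ?thesis by simp
qed

lemma S_eq_sum: "\<omega> \<in> space M \<Longrightarrow> S n \<omega> = (\<Sum>i=1..n. \<sigma> i \<omega>)"
  by (induction n) (auto simp: S_0 S_Suc)

text \<open>
Averaging over the recalled time \<open>j\<close>, which is uniform and independent of the past, leaves
\<open>\<Sum>\<^sub>j p f (S\<^sub>n + \<sigma>\<^sub>j) + (1 - p) f (S\<^sub>n - \<sigma>\<^sub>j)\<close> divided by \<open>n\<close>.  This sum is affine in each
\<open>\<sigma>\<^sub>j = \<plusminus>1\<close>, and so depends on the steps only through their sum \<open>S\<^sub>n\<close>.
The weight \<open>g\<close> stands for conditioning on the past.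
\<close>

lemma markov_step:
  fixes g :: "'a \<Rightarrow> real" and f :: "int \<Rightarrow> real"
  assumes g: "adapted n g" and n: "n \<ge> 1"
  shows "(\<integral>\<omega>. g \<omega> * f (S (Suc n) \<omega>) \<partial>M) = (\<integral>\<omega>. g \<omega> * erw_op p n f (S n \<omega>) \<partial>M)"
proof -
  let ?u = "\<lambda>j \<omega>. g \<omega> * f (S n \<omega> + \<sigma> j \<omega>)" and ?d = "\<lambda>j \<omega>. g \<omega> * f (S n \<omega> - \<sigma> j \<omega>)"
  let ?m = "\<lambda>j \<omega>. of_bool (mem n \<omega> = j) :: real"
  let ?R = "\<lambda>\<omega>. of_bool (\<sigma> (Suc n) \<omega> = \<sigma> (mem n \<omega>) \<omega>) :: real"
  let ?F = "\<lambda>\<omega>. of_bool (\<sigma> (Suc n) \<omega> = - \<sigma> (mem n \<omega>) \<omega>) :: real"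
  have [measurable]: "Measurable.pred M (\<lambda>\<omega>. \<sigma> (Suc n) \<omega> = \<sigma> (mem n \<omega>) \<omega>)"
      "Measurable.pred M (\<lambda>\<omega>. \<sigma> (Suc n) \<omega> = - \<sigma> (mem n \<omega>) \<omega>)"
      "\<And>j. Measurable.pred M (\<lambda>\<omega>. mem n \<omega> = j)"
    using n by auto
  have ud: "adapted n (?u j)" "adapted n (?d j)" if "j \<in> {1..n}" for j
    using that adapted_comp2[OF g adapted_comp2[OF adapted_S[of n n] adapted_step[of j n], of "\<lambda>x y. f (x
        + y)"], of "(*)"]
      adapted_comp2[OF g adapted_comp2[OF adapted_S[of n n] adapted_step[of j n], of "\<lambda>x y. f (x - y)"],
          of "(*)"]
    by auto
  have bdd: "integrable M (\<lambda>\<omega>. G \<omega> * of_bool (P \<omega>))" if "integrable M G"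
      "Measurable.pred M P" for G :: "'a \<Rightarrow> real" and P
  proof -
    have [measurable]: "Measurable.pred M P" "G \<in> borel_measurable M" using that by auto
    show ?thesis using that(1) by (rule Bochner_Integration.integrable_bound) auto
  qed
  have udi: "integrable M (?u j)" "integrable M (?d j)" if "j \<in> {1..n}" for j
    using ud[OF that] adapted_integrable by blast+
  have umi: "integrable M (\<lambda>\<omega>. ?u j \<omega> * ?m j \<omega>)" "integrable M (\<lambda>\<omega>. ?d j \<omega> * ?m j \<omega>)" if "j \<in> {1..n}" for j
    by (rule bdd, rule udi[OF that], measurable)+
  have umRi: "integrable M (\<lambda>\<omega>. ?u j \<omega> * ?m j \<omega> * ?R \<omega>)" "integrable M (\<lambda>\<omega>. ?d j \<omega> * ?m j \<omega> * ?F \<omega>)"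
      if "j \<in> {1..n}" for j
    by (rule bdd, rule umi[OF that], measurable)+
  have S1: "S (Suc n) \<omega> = S n \<omega> + \<sigma> (Suc n) \<omega>" if "\<omega> \<in> space M" for \<omega> using S_Suc that by blast
  have "adapted (Suc n) (\<lambda>\<omega>. g \<omega> * f (S (Suc n) \<omega>))"
    by (intro adapted_comp2[of _ _ _ "(*)"] adapted_mono[OF g] adapted_comp[of _ _ f] adapted_S) auto
  then have meas1: "(\<lambda>\<omega>. g \<omega> * f (S (Suc n) \<omega>)) \<in> borel_measurable M"
    by (rule adapted_borel_measurable)
  \<comment> \<open>Split according to the recalled time and to whether the recalled step is repeated or flipped.\<close>
  have "(\<integral>\<omega>. g \<omega> * f (S (Suc n) \<omega>) \<partial>M)
      = (\<integral>\<omega>. (\<Sum>j=1..n. ?u j \<omega> * ?m j \<omega> * ?R \<omega> + ?d j \<omega> * ?m j \<omega> * ?F \<omega>) \<partial>M)"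
  proof (rule integral_cong_AE)
    show "(\<lambda>\<omega>. (\<Sum>j=1..n. ?u j \<omega> * ?m j \<omega> * ?R \<omega> + ?d j \<omega> * ?m j \<omega> * ?F \<omega>)) \<in> borel_measurable M"
      by (intro borel_measurable_sum borel_measurable_add borel_measurable_integrable umRi)
    show "AE \<omega> in M. g \<omega> * f (S (Suc n) \<omega>) = (\<Sum>j=1..n. ?u j \<omega> * ?m j \<omega> * ?R \<omega> + ?d j \<omega> * ?m j \<omega> * ?F \<omega>)"
      using mem_range[OF n] steps_pm1[of "Suc n"] AE_space
    proof eventually_elim
      case (elim \<omega>)
      let ?i = "mem n \<omega>"
      have i: "\<sigma> ?i \<omega> = 1 \<or> \<sigma> ?i \<omega> = -1" "\<sigma> (Suc n) \<omega> = 1 \<or> \<sigma> (Suc n) \<omega> = -1" "?i \<in> {1..n}"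
          using elim by auto
      have "(\<Sum>j=1..n. ?u j \<omega> * ?m j \<omega> * ?R \<omega> + ?d j \<omega> * ?m j \<omega> * ?F \<omega>) =
          (\<Sum>j=1..n. if j = ?i then ?u ?i \<omega> * ?R \<omega> + ?d ?i \<omega> * ?F \<omega> else 0)"
        by (rule sum.cong) auto
      also have "\<dots> = ?u ?i \<omega> * ?R \<omega> + ?d ?i \<omega> * ?F \<omega>"
        using i by (subst sum.delta) auto
      also have "\<dots> = g \<omega> * f (S (Suc n) \<omega>)"
        using i S1[OF elim(3)] by auto
      finally show ?case by simp
    qed
  qed (rule meas1)
  also have "\<dots> = (\<Sum>j=1..n. (\<integral>\<omega>. ?u j \<omega> * ?m j \<omega> * ?R \<omega> \<partial>M) + (\<integral>\<omega>. ?d j \<omega> * ?m j \<omega> * ?F \<omega> \<partial>M))"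
    by (subst Bochner_Integration.integral_sum)
       (intro Bochner_Integration.integrable_add umRi sum.cong refl Bochner_Integration.integral_add;
           assumption)+
  also have "\<dots> = (\<Sum>j=1..n. p * (\<integral>\<omega>. ?u j \<omega> * ?m j \<omega> \<partial>M) + (1 - p) * (\<integral>\<omega>. ?d j \<omega> * ?m j \<omega> \<partial>M))"
    by (intro sum.cong refl arg_cong2[where f="(+)"] repeat_flip n umi mem_indicator_mult_measurable ud)
  also have "\<dots> = (\<Sum>j=1..n. p * ((1/n) * (\<integral>\<omega>. ?u j \<omega> \<partial>M)) + (1 - p) * ((1/n) * (\<integral>\<omega>. ?d j \<omega> \<partial>M)))"
    by (intro sum.cong refl) (use mem_indep_integral ud in simp)
  also have "\<dots> = (\<integral>\<omega>. (\<Sum>j=1..n. p * ((1/n) * ?u j \<omega>) + (1 - p) * ((1/n) * ?d j \<omega>)) \<partial>M)"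
    by (subst Bochner_Integration.integral_sum) (use udi in \<open>auto intro!: sum.cong\<close>)
  also have "\<dots> = (\<integral>\<omega>. g \<omega> * erw_op p n f (S n \<omega>) \<partial>M)"
  proof (rule integral_cong_AE)
    show "(\<lambda>\<omega>. (\<Sum>j=1..n. p * ((1/n) * ?u j \<omega>) + (1 - p) * ((1/n) * ?d j \<omega>))) \<in> borel_measurable M"
      by (intro borel_measurable_sum borel_measurable_add borel_measurable_times borel_measurable_const
          borel_measurable_integrable udi)
    have "adapted n (\<lambda>\<omega>. g \<omega> * erw_op p n f (S n \<omega>))"
      by (intro adapted_comp2[of _ _ _ "(*)"] adapted_mono[OF g] adapted_comp[of _ _ "erw_op p n f"]
          adapted_S) auto
    then show "(\<lambda>\<omega>. g \<omega> * erw_op p n f (S n \<omega>)) \<in> borel_measurable M"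
      by (rule adapted_borel_measurable)
    show "AE \<omega> in M. (\<Sum>j=1..n. p * ((1/n) * ?u j \<omega>) + (1 - p) * ((1/n) * ?d j \<omega>))
        = g \<omega> * erw_op p n f (S n \<omega>)"
      using steps_pm1[of n] AE_space
    proof eventually_elim
      case (elim \<omega>)
      define s where "s = S n \<omega>"
      \<comment> \<open>\<open>A\<close> and \<open>B\<close> are the summands for an upward and a downward recalled step, up to the factor \<open>g \<omega> / n\<close>.\<close>
      define A where "A = (p * f (s+1) + (1-p) * f (s-1))"
      define B where "B = (p * f (s-1) + (1-p) * f (s+1))"
      have "(\<Sum>j=1..n. p * ((1/n) * ?u j \<omega>) + (1 - p) * ((1/n) * ?d j \<omega>)) =
         (\<Sum>j=1..n. (g \<omega> / n) * ((A + B) / 2 + (A - B) / 2 * \<sigma> j \<omega>))"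
      proof (rule sum.cong, simp)
        fix j assume "j \<in> {1..n}"
        then have "\<sigma> j \<omega> = 1 \<or> \<sigma> j \<omega> = -1" using elim by auto
        then show "p * ((1/n) * ?u j \<omega>) + (1 - p) * ((1/n) * ?d j \<omega>)
            = (g \<omega> / n) * ((A + B) / 2 + (A - B) / 2 * \<sigma> j \<omega>)"
          using n by (auto simp: A_def B_def s_def field_simps)
      qed
      also have "\<dots> = (g \<omega> / n) * (n * ((A + B) / 2) + (A - B) / 2 * s)"
        unfolding s_def S_eq_sum[OF elim(2)]
        by (simp only: sum_distrib_left[symmetric] sum.distrib of_int_sum sum_constant) simp
      also have "\<dots> = g \<omega> * erw_op p n f s"
        using n unfolding erw_op_def srw_op_def A_def B_def by (simp add: field_simps)
      finally show ?case by (simp add: s_def)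
    qed
  qed
  finally show ?thesis .
qed

lemma adapted_mult: "adapted n g \<Longrightarrow> adapted n h \<Longrightarrow> adapted n (\<lambda>\<omega>. g \<omega> * h \<omega>)"
  by (rule adapted_comp2[where f = "(*)"])

lemma adapted_of_bool: "adapted n P \<Longrightarrow> adapted n (\<lambda>\<omega>. of_bool (P \<omega>))"
  by (rule adapted_comp[where f = of_bool])

lemma adapted_fun_S: "k \<le> n \<Longrightarrow> adapted n (\<lambda>\<omega>. f (S k \<omega>))"
  by (rule adapted_comp[where f = f, OF adapted_S])

lemmas adapted_intros = adapted_mult adapted_of_bool adapted_fun_S adapted_all adapted_const

lemma S_path: "AE \<omega> in M. S 0 \<omega> = 0 \<and> S 1 \<omega> = 1 \<and> (\<forall>n. S (Suc n) \<omega> = S n \<omega> + 1 \<or> S (Suc n) \<omega> = S n \<omega> - 1)"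
proof -
  have "AE \<omega> in M. \<forall>n. \<forall>i\<in>{1..n}. \<sigma> i \<omega> = 1 \<or> \<sigma> i \<omega> = -1"
    using steps_pm1 by (simp add: AE_all_countable)
  with first_step AE_space show ?thesis
  proof eventually_elim
    case (elim \<omega>)
    have "\<sigma> (Suc n) \<omega> = 1 \<or> \<sigma> (Suc n) \<omega> = -1" for n
      using elim(3)[rule_format, of "Suc n" "Suc n"] by simp
    then show ?case using S_0[OF elim(2)] S_Suc[OF elim(2)] elim(1) by (auto simp: One_nat_def)
  qed
qed

lemma S_measurable [measurable]: "S n \<in> measurable M (count_space UNIV)"
proof -
  have "S n -` {c} \<inter> space M \<in> sets M" for c
  proof -
    have "(\<lambda>\<omega>. of_bool (S n \<omega> = c) :: real) \<in> borel_measurable M"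
      by (rule adapted_borel_measurable[OF adapted_of_bool[OF adapted_fun_S[of n n "\<lambda>s. s = c"]]]) simp
    then have "(\<lambda>\<omega>. of_bool (S n \<omega> = c) :: real) -` {1} \<inter> space M \<in> sets M"
      by (rule measurable_sets) simp
    moreover have "(\<lambda>\<omega>. of_bool (S n \<omega> = c) :: real) -` {1} \<inter> space M = S n -` {c} \<inter> space M"
      by auto
    ultimately show ?thesis by simp
  qed
  then show ?thesis
    by (subst measurable_count_space_eq_countable) auto
qed

lemma expectation_mono_AE:
  assumes "adapted n g" "adapted n h" "AE \<omega> in M. g \<omega> \<le> (h \<omega> :: real)"
  shows "(\<integral>\<omega>. g \<omega> \<partial>M) \<le> (\<integral>\<omega>. h \<omega> \<partial>M)"
  by (rule integral_mono_AE) (use assms adapted_integrable in auto)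

lemma expectation_eq_AE:
  assumes "adapted n g" "adapted n h" "AE \<omega> in M. g \<omega> = (h \<omega> :: real)"
  shows "(\<integral>\<omega>. g \<omega> \<partial>M) = (\<integral>\<omega>. h \<omega> \<partial>M)"
  by (rule integral_cong_AE) (use assms adapted_borel_measurable in auto)

end

section \<open>Domination by the simple random walk and return probabilities\<close>

context elephant_random_walk
begin

text \<open>
The last of the \<open>j\<close> steps of the elephant is exchanged for a step of the simple walk first; the
resulting function is again radially monotone, so the exchange can be iterated.
\<close>

lemma srw_domination:
  fixes g :: "'a \<Rightarrow> real"
  assumes n: "n \<ge> 1" and g: "adapted n g" and g0: "\<And>\<omega>. 0 \<le> g \<omega>"
    and f: "radially_monotone (2 * p - 1) f"
  shows "(\<integral>\<omega>. g \<omega> * (srw_op ^^ j) f (S n \<omega>) \<partial>M) \<le> (\<integral>\<omega>. g \<omega> * f (S (n + j) \<omega>) \<partial>M)"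
  using f
proof (induction j arbitrary: f)
  case 0 then show ?case by simp
next
  case (Suc j)
  have g': "adapted (n + j) g" by (rule adapted_mono[OF g]) simp
  have "(\<integral>\<omega>. g \<omega> * (srw_op ^^ Suc j) f (S n \<omega>) \<partial>M) = (\<integral>\<omega>. g \<omega> * (srw_op ^^ j) (srw_op f) (S n \<omega>) \<partial>M)"
    by (simp only: funpow_Suc_right o_apply)
  also have "\<dots> \<le> (\<integral>\<omega>. g \<omega> * srw_op f (S (n + j) \<omega>) \<partial>M)"
    by (intro Suc.IH srw_op_radially_monotone Suc.prems)
  also have "\<dots> \<le> (\<integral>\<omega>. g \<omega> * erw_op p (n + j) f (S (n + j) \<omega>) \<partial>M)"
    by (rule expectation_mono_AE[of "n + j"])
       (auto intro!: adapted_mult g' adapted_fun_S mult_left_mono g0 srw_op_le_erw_op Suc.prems)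
  also have "\<dots> = (\<integral>\<omega>. g \<omega> * f (S (Suc (n + j)) \<omega>) \<partial>M)"
    by (rule markov_step[symmetric]) (use n g' in auto)
  finally show ?case by simp
qed

end

lemma srw_op_iter_eq_binomial_sum:
  "(srw_op ^^ j) f s = (\<Sum>i\<le>j. real (j choose i) / 2 ^ j * f (s + 2 * int i - int j))"
proof (induction j arbitrary: s)
  case (Suc j)
  let ?b = "\<lambda>j i. real (j choose i) / 2 ^ j"
  have up: "(\<Sum>i\<le>j. ?b j i * f (s + 1 + 2 * int i - int j))
      = (\<Sum>i\<in>{1..Suc j}. ?b j (i - 1) * f (s + 2 * int i - int (Suc j)))"
    by (rule sum.reindex_bij_witness[of _ "\<lambda>i. i - 1" Suc]) (auto simp: algebra_simps)
  have up': "\<dots> = (\<Sum>i\<le>Suc j. (if i = 0 then 0 else ?b j (i - 1)) * f (s + 2 * int i - int (Suc j)))"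
    by (rule sum.mono_neutral_cong_left) auto
  have down: "(\<Sum>i\<le>j. ?b j i * f (s - 1 + 2 * int i - int j))
      = (\<Sum>i\<le>Suc j. ?b j i * f (s + 2 * int i - int (Suc j)))"
    by (simp add: algebra_simps)
  have "(srw_op ^^ Suc j) f s = ((\<Sum>i\<le>j. ?b j i * f (s + 1 + 2 * int i - int j))
      + (\<Sum>i\<le>j. ?b j i * f (s - 1 + 2 * int i - int j))) / 2"
    by (simp add: srw_op_def Suc.IH)
  also have "\<dots> = (\<Sum>i\<le>Suc j. ((if i = 0 then 0 else ?b j (i - 1)) + ?b j i) / 2 * f (s
      + 2 * int i - int (Suc j)))"
    unfolding up up' down sum.distrib[symmetric] sum_divide_distrib
        by (intro sum.cong refl) (simp add: field_simps)
  also have "\<dots> = (\<Sum>i\<le>Suc j. ?b (Suc j) i * f (s + 2 * int i - int (Suc j)))"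
  proof (rule sum.cong[OF refl])
    fix i
    have "((if i = 0 then 0 else ?b j (i - 1)) + ?b j i) / 2 = ?b (Suc j) i"
      by (cases i) (simp_all add: field_simps)
    then show "((if i = 0 then 0 else ?b j (i - 1)) + ?b j i) / 2 * f (s + 2 * int i - int (Suc j))
        = ?b (Suc j) i * f (s + 2 * int i - int (Suc j))"
      by simp
  qed
  finally show ?case .
qed simp

lemma srw_return_probability: "(srw_op ^^ (2 * n)) (\<lambda>s. of_bool (s = 0)) 0 = real (2 * n choose n) / 4 ^ n"
proof -
  have "(srw_op ^^ (2 * n)) (\<lambda>s. of_bool (s = 0)) 0
      = (\<Sum>i\<le>2*n. if i = n then real (2 * n choose n) / 4 ^ n else 0)"
    unfolding srw_op_iter_eq_binomial_sum by (intro sum.cong refl) (auto simp: power_mult)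
  then show ?thesis by (simp add: sum.delta)
qed

text \<open>
With \<open>W\<^sub>n\<close> the partial products in Wallis' formula and \<open>c\<^sub>n\<close> the central binomial probability,
\<open>(2 n + 1) W\<^sub>n c\<^sub>n\<^sup>2 = 1\<close>.
\<close>

lemma central_binomial_asymptotics:
  "(\<lambda>n. sqrt (pi * n) * (real (2 * n choose n) / 4 ^ n)) \<longlonglongrightarrow> 1"
proof -
  define W where "W n = (\<Prod>k=1..n. (4 * real k ^ 2) / (4 * real k ^ 2 - 1))" for n
  define c where "c n = real (2 * n choose n) / 4 ^ n" for n
  have c_Suc: "c (Suc n) = c n * ((2 * n + 1) / (2 * n + 2))" for n
  proof -
    have 1: "Suc (2 * n) * (2 * n choose n) = Suc n * (Suc (2 * n) choose Suc n)"
      using Suc_times_binomial_eq[of "2 * n" n] by (simp only: mult.commute)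
    have "Suc n * (2 * Suc n choose Suc n) = (2 * n + 2) * (Suc (2 * n) choose n)"
      using Suc_times_binomial_eq[of "Suc (2 * n)" n] by (simp add: mult.commute)
    moreover have "Suc (2 * n) choose n = Suc (2 * n) choose Suc n"
      by (subst binomial_symmetric) auto
    ultimately have "real (Suc n) * real (2 * Suc n choose Suc n)
        = real (2 * n + 2) * real (Suc (2 * n) choose Suc n)"
      by (metis of_nat_mult)
    moreover have "real (Suc (2 * n)) * real (2 * n choose n)
        = real (Suc n) * real (Suc (2 * n) choose Suc n)"
      using 1 by (metis of_nat_mult)
    ultimately have "real (Suc n) * (real (Suc n) * real (2 * Suc n choose Suc n))
        = real (2 * n + 2) * (real (Suc (2 * n)) * real (2 * n choose n))"
      by simp
    then have rec: "(real n + 1) * ((real n + 1) * real (2 * Suc n choose Suc n))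
        = (2 * real n + 2) * ((2 * real n + 1) * real (2 * n choose n))"
      by (simp only: of_nat_Suc of_nat_add of_nat_mult of_nat_numeral add.commute)
    have cancel: "A = 2 * (2 * r + 1) / (r + 1) * B"
      if "(r + 1) * ((r + 1) * A) = (2 * r + 2) * ((2 * r + 1) * B)" "r \<ge> 0" for A B r :: real
    proof -
      have "(r + 1) * ((r + 1) * A) = (r + 1) * (2 * (2 * r + 1) * B)"
        using that(1) by (simp add: algebra_simps)
      then have "(r + 1) * A = 2 * (2 * r + 1) * B"
        using that(2) by (simp only: mult_cancel_left) auto
      then show ?thesis using that(2) by (simp add: field_simps)
    qed
    have "real (2 * Suc n choose Suc n) = 2 * (2 * real n + 1) / (real n + 1) * real (2 * n choose n)"
      by (rule cancel[OF rec]) simp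
    then have "c (Suc n) = 2 * (2 * real n + 1) / (real n + 1) * real (2 * n choose n) / 4 ^ Suc n"
      by (simp only: c_def)
    moreover have "2 * R / D * B / (4 * P) = B / P * (R / (2 * D))" for R D B P :: real
      by simp
    from this[of _ "real n + 1" _ "4 ^ n"] have "2 * (2 * real n + 1) / (real n
        + 1) * real (2 * n choose n) / 4 ^ Suc n
        = real (2 * n choose n) / 4 ^ n * ((2 * real n + 1) / (2 * real n + 2))"
      by (simp only: power_Suc distrib_left[of 2 "real n" 1] mult_1_right)
    ultimately show ?thesis by (simp only: c_def of_nat_add of_nat_mult of_nat_numeral of_nat_1)
  qed
  have c_pos: "c n > 0" for n by (simp add: c_def)
  have W: "W n * (2 * n + 1) * (c n)\<^sup>2 = 1" for n
  proof (induction n)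
    case 0 show ?case by (simp add: W_def c_def)
  next
    case (Suc n)
    have WS: "W (Suc n) = W n * ((4 * (real n + 1) ^ 2) / (4 * (real n + 1) ^ 2 - 1))"
      by (simp add: W_def add.commute)
    have "4 * (real n + 1) ^ 2 - 1 = (2 * real n + 1) * (2 * real n + 3)"
        by (simp add: power2_eq_square algebra_simps)
    moreover have "(2 * real n + 1) \<noteq> 0" "(2 * real n + 3) \<noteq> 0" by linarith+
    ultimately have "(4 * (real n + 1) ^ 2) / (4 * (real n + 1) ^ 2 - 1) * (2 * real n
        + 3) * ((2 * n + 1) / (2 * n + 2))\<^sup>2 = 2 * n + 1"
      by (simp add: divide_simps) (simp add: power2_eq_square algebra_simps)
    then have "W (Suc n) * (2 * Suc n + 1) * (c (Suc n))\<^sup>2 = W n * (2 * n + 1) * (c n)\<^sup>2"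
    proof -
      have "w * X * (2 * r + 3) * (d * Y)\<^sup>2 = w * (2 * r + 1) * d\<^sup>2"
        if "X * (2 * r + 3) * Y\<^sup>2 = 2 * r + 1" for w X Y d r :: real
      proof -
        have "w * X * (2 * r + 3) * (d * Y)\<^sup>2 = w * (X * (2 * r + 3) * Y\<^sup>2) * d\<^sup>2"
          by (simp add: power_mult_distrib)
        then show ?thesis unfolding that .
      qed
      from this[OF \<open>_ = real (2 * n + 1)\<close>[simplified of_nat_add of_nat_mult of_nat_numeral of_nat_1], of
          "W n" "c n"]
      show ?thesis unfolding WS c_Suc by (simp add: add.commute)
    qed
    with Suc.IH show ?case by simp
  qed
  have eq: "sqrt (pi * n) * c n = sqrt (pi * (n / (2 * n + 1)) / W n)" for n
  proof -
    have Wp: "W n \<noteq> 0" using W[of n] by auto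
    have nz: "W n * real (2 * n + 1) \<noteq> 0" using Wp by simp
    have "(c n)\<^sup>2 = 1 / (W n * real (2 * n + 1))"
      unfolding nonzero_eq_divide_eq[OF nz] using W[of n] by (simp only: mult.commute)
    then have "pi * n * (c n)\<^sup>2 = pi * (n / (2 * n + 1)) / W n" by simp
    moreover have "sqrt (pi * n) * c n = sqrt (pi * n * (c n)\<^sup>2)"
      using c_pos[of n] by (simp add: real_sqrt_mult)
    ultimately show ?thesis by simp
  qed
  have "(\<lambda>n. n / (2 * real n + 1)) \<longlonglongrightarrow> 1/2" by real_asymp
  then have "(\<lambda>n. sqrt (pi * (n / (2 * real n + 1)) / W n)) \<longlonglongrightarrow> sqrt (pi * (1/2) / (pi / 2))"
    by (rule tendsto_real_sqrt[OF tendsto_divide[OF tendsto_mult_left]])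
        (use wallis in \<open>auto simp: W_def[abs_def]\<close>)
  then show ?thesis using eq unfolding c_def by simp
qed

context elephant_random_walk
begin

text \<open>
Up to the sign \<open>c\<close>, the indicator of the origin is radially monotone for the drift.  The deterministic
first step to \<open>1\<close> costs nothing: for an even function, a simple walk at \<open>0\<close> may as well be moved to \<open>1\<close>.
\<close>

lemma return_probability_comparison:
  assumes n: "n \<ge> 1" and c: "0 \<le> (1 - 2 * p) * c"
  shows "c * (real (2 * n choose n) / 4 ^ n) \<le> c * \<P>(\<omega> in M. S (2 * n) \<omega> = 0)"
proof -
  define f :: "int \<Rightarrow> real" where "f s = c * of_bool (s = 0)" for s
  have rm: "radially_monotone (2 * p - 1) f"
    using c by (auto simp: radially_monotone_def f_def of_bool_def algebra_simps)
  define j where "j = 2 * n - 1"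
  have j: "2 * n = Suc j" "1 + j = 2 * n" using n by (auto simp: j_def)
  have even: "(srw_op ^^ j) f (- s) = (srw_op ^^ j) f s" for s
    using srw_op_iter_radially_monotone[OF rm] by (simp add: radially_monotone_def)
  have "c * (real (2 * n choose n) / 4 ^ n) = c * (srw_op ^^ (2 * n)) (\<lambda>s. of_bool (s = 0)) 0"
    by (simp only: srw_return_probability)
  also have "\<dots> = (srw_op ^^ (2 * n)) f 0"
    unfolding srw_op_iter_eq_binomial_sum f_def sum_distrib_left by (intro sum.cong) auto
  also have "\<dots> = (srw_op ^^ j) f 1"
    unfolding j(1) using even[of 1] by (simp add: srw_op_def)
  also have "\<dots> = (\<integral>\<omega>. (srw_op ^^ j) f 1 \<partial>M)" by (simp add: prob_space)
  also have "\<dots> = (\<integral>\<omega>. 1 * (srw_op ^^ j) f (S 1 \<omega>) \<partial>M)"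
  proof (rule expectation_eq_AE[of 1])
    show "AE \<omega> in M. (srw_op ^^ j) f 1 = 1 * (srw_op ^^ j) f (S 1 \<omega>)"
      using S_path by eventually_elim simp
  qed (auto intro!: adapted_mult adapted_fun_S)
  also have "\<dots> \<le> (\<integral>\<omega>. 1 * f (S (1 + j) \<omega>) \<partial>M)"
    by (rule srw_domination[OF _ _ _ rm]) auto
  also have "\<dots> = (\<integral>\<omega>. c * indicator {\<omega> \<in> space M. S (2 * n) \<omega> = 0} \<omega> \<partial>M)"
    unfolding j(2) by (rule Bochner_Integration.integral_cong) (auto simp: f_def)
  also have "\<dots> = c * \<P>(\<omega> in M. S (2 * n) \<omega> = 0)" by simp
  finally show ?thesis .
qed

lemma return_probability_liminf:
  assumes "p \<le> 1/2"
  shows "1 \<le> liminf (\<lambda>n. ereal (sqrt (pi * real n) * \<P>(\<omega> in M. S (2 * n) \<omega> = 0)))"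
proof -
  let ?b = "\<lambda>n. sqrt (pi * real n) * (real (2 * n choose n) / 4 ^ n)"
  have "liminf (\<lambda>n. ereal (?b n)) = ereal 1"
    by (rule lim_imp_Liminf) (use central_binomial_asymptotics in auto)
  moreover have "liminf (\<lambda>n. ereal (?b n))
      \<le> liminf (\<lambda>n. ereal (sqrt (pi * real n) * \<P>(\<omega> in M. S (2 * n) \<omega> = 0)))"
  proof (rule Liminf_mono)
    show "eventually (\<lambda>n. ereal (?b n)
        \<le> ereal (sqrt (pi * real n) * \<P>(\<omega> in M. S (2 * n) \<omega> = 0))) sequentially"
      using eventually_ge_at_top[of 1]
    proof eventually_elim
      case (elim n)
      then have "real (2 * n choose n) / 4 ^ n \<le> \<P>(\<omega> in M. S (2 * n) \<omega> = 0)"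
        using return_probability_comparison[of n 1] assms by simp
      then show ?case unfolding ereal_less_eq by (rule mult_left_mono) simp
    qed
  qed
  ultimately show ?thesis by (simp add: one_ereal_def)
qed

lemma return_probability_limsup:
  assumes "p \<ge> 1/2"
  shows "limsup (\<lambda>n. ereal (sqrt (pi * real n) * \<P>(\<omega> in M. S (2 * n) \<omega> = 0))) \<le> 1"
proof -
  let ?b = "\<lambda>n. sqrt (pi * real n) * (real (2 * n choose n) / 4 ^ n)"
  have "limsup (\<lambda>n. ereal (?b n)) = ereal 1"
    by (rule lim_imp_Limsup) (use central_binomial_asymptotics in auto)
  moreover have "limsup (\<lambda>n. ereal (sqrt (pi * real n) * \<P>(\<omega> in M. S (2 * n) \<omega> = 0)))
      \<le> limsup (\<lambda>n. ereal (?b n))"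
  proof (rule Limsup_mono)
    show "eventually (\<lambda>n. ereal (sqrt (pi * real n) * \<P>(\<omega> in M. S (2 * n) \<omega> = 0))
        \<le> ereal (?b n)) sequentially"
      using eventually_ge_at_top[of 1]
    proof eventually_elim
      case (elim n)
      then have "\<P>(\<omega> in M. S (2 * n) \<omega> = 0) \<le> real (2 * n choose n) / 4 ^ n"
        using return_probability_comparison[of n "-1"] assms by simp
      then show ?case unfolding ereal_less_eq by (rule mult_left_mono) simp
    qed
  qed
  ultimately show ?thesis by (simp add: one_ereal_def)
qed

end

section \<open>Expected exit times\<close>

context elephant_random_walk
begin

definition confined :: "nat \<Rightarrow> nat \<Rightarrow> 'a \<Rightarrow> bool" where
  "confined m n \<omega> \<longleftrightarrow> (\<forall>k\<in>{..n}. \<bar>S k \<omega>\<bar> < int m)"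

lemma adapted_confined: "adapted n (confined m n)"
  unfolding confined_def[abs_def] by (intro adapted_intros) auto

lemma adapted_confined_mult: "n \<le> N \<Longrightarrow> k \<le> N \<Longrightarrow> adapted N (\<lambda>\<omega>. of_bool (confined m n \<omega>) * f (S k \<omega>) :: real)"
  by (intro adapted_intros adapted_mono[OF adapted_confined])

definition confined_prob :: "nat \<Rightarrow> nat \<Rightarrow> real" where
  "confined_prob m n = (\<integral>\<omega>. of_bool (confined m n \<omega>) \<partial>M)"

lemma confined_prob_bounds: "0 \<le> confined_prob m n" "confined_prob m n \<le> 1"
proof -
  show "0 \<le> confined_prob m n" unfolding confined_prob_def
      by (rule Bochner_Integration.integral_nonneg) auto
  have "confined_prob m n \<le> (\<integral>\<omega>. 1 \<partial>M)" unfolding confined_prob_def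
    by (rule expectation_mono_AE[of n]) (auto intro!: adapted_of_bool adapted_confined)
  then show "confined_prob m n \<le> 1" by (simp add: prob_space)
qed

lemma pred_S [measurable]: "Measurable.pred M (\<lambda>\<omega>. P (S k \<omega>))"
  by (rule measurable_compose[OF S_measurable]) simp

lemma confined_pred [measurable]: "Measurable.pred M (confined m n)"
  unfolding confined_def[abs_def] by measurable

lemma confined_prob_eq: "confined_prob m n = \<P>(\<omega> in M. confined m n \<omega>)"
proof -
  have "confined_prob m n = (\<integral>\<omega>. indicator {\<omega> \<in> space M. confined m n \<omega>} \<omega> \<partial>M)"
    unfolding confined_prob_def by (intro Bochner_Integration.integral_cong) auto
  then show ?thesis by simp
qed

lemma confined_prob_0: "m > 0 \<Longrightarrow> confined_prob m 0 = 1"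
  unfolding confined_prob_eq using S_path
  by (subst prob_Collect_eq_1) (auto simp: confined_def elim!: eventually_mono)

text \<open>
Steps have size one, so the mass that leaves the strip at time \<open>n + 1\<close> sits exactly at height \<open>m\<close>.
\<close>

lemma exit_balance:
  assumes "\<And>s. \<bar>s\<bar> = int m \<Longrightarrow> F s = y"
  shows "(\<integral>\<omega>. of_bool (confined m n \<omega>) * F (S (Suc n) \<omega>) \<partial>M)
    = (\<integral>\<omega>. of_bool (confined m (Suc n) \<omega>) * F (S (Suc n) \<omega>) \<partial>M)
        + y * (confined_prob m n - confined_prob m (Suc n))"
proof -
  let ?c = "\<lambda>n \<omega>. of_bool (confined m n \<omega>) :: real"
  have ad: "adapted (Suc n) (?c n)" "adapted (Suc n) (?c (Suc n))"
    by (auto intro!: adapted_of_bool adapted_mono[OF adapted_confined])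
  have adF: "adapted (Suc n) (\<lambda>\<omega>. ?c n \<omega> * F (S (Suc n) \<omega>))"
      "adapted (Suc n) (\<lambda>\<omega>. ?c (Suc n) \<omega> * F (S (Suc n) \<omega>))"
    by (auto intro!: adapted_confined_mult)
  have "(\<integral>\<omega>. ?c n \<omega> * F (S (Suc n) \<omega>) \<partial>M)
      = (\<integral>\<omega>. ?c (Suc n) \<omega> * F (S (Suc n) \<omega>) + y * (?c n \<omega> - ?c (Suc n) \<omega>) \<partial>M)"
  proof (rule expectation_eq_AE[of "Suc n"])
    show "adapted (Suc n) (\<lambda>\<omega>. ?c (Suc n) \<omega> * F (S (Suc n) \<omega>) + y * (?c n \<omega> - ?c (Suc n) \<omega>))"
      by (intro adapted_comp2[of _ _ _ "(+)"] adapted_comp2[of _ _ _ "(-)"] adapted_mult adF ad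
          adapted_const)
    show "AE \<omega> in M. ?c n \<omega> * F (S (Suc n) \<omega>) = ?c (Suc n) \<omega> * F (S (Suc n) \<omega>)
        + y * (?c n \<omega> - ?c (Suc n) \<omega>)"
      using S_path
    proof eventually_elim
      case (elim \<omega>)
      have step: "confined m (Suc n) \<omega> \<longleftrightarrow> confined m n \<omega> \<and> \<bar>S (Suc n) \<omega>\<bar> < int m"
        unfolding confined_def by (auto simp: le_Suc_eq)
      have "\<bar>S (Suc n) \<omega>\<bar> = int m" if "confined m n \<omega>" "\<not> \<bar>S (Suc n) \<omega>\<bar> < int m"
      proof -
        have "\<bar>S n \<omega>\<bar> < int m" using that(1) by (auto simp: confined_def)
        moreover have "S (Suc n) \<omega> = S n \<omega> + 1 \<or> S (Suc n) \<omega> = S n \<omega> - 1" using elim by blast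
        ultimately show ?thesis using that(2) by linarith
      qed
      then show ?case using step assms by (auto simp: of_bool_def)
    qed
  qed (rule adF)
  also have "\<dots> = (\<integral>\<omega>. ?c (Suc n) \<omega> * F (S (Suc n) \<omega>) \<partial>M)
      + y * (confined_prob m n - confined_prob m (Suc n))"
    unfolding confined_prob_def using adF[THEN adapted_integrable] ad[THEN adapted_integrable] by simp
  finally show ?thesis .
qed

lemma expectation_S_1: "(\<integral>\<omega>. of_bool (confined m 0 \<omega>) * F (S (Suc 0) \<omega>) \<partial>M)
    = (if m > 0 then F 1 else 0 :: real)"
proof -
  have "(\<integral>\<omega>. of_bool (confined m 0 \<omega>) * F (S (Suc 0) \<omega>) \<partial>M) = (\<integral>\<omega>. (if m > 0 then F 1 else 0) \<partial>M)"
  proof (rule expectation_eq_AE[of 1])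
    show "AE \<omega> in M. of_bool (confined m 0 \<omega>) * F (S (Suc 0) \<omega>) = (if m > 0 then F 1 else 0)"
      using S_path by eventually_elim (auto simp: confined_def)
  qed (auto intro!: adapted_confined_mult)
  then show ?thesis by (simp add: prob_space)
qed

lemma erw_op_square: "n \<ge> 1 \<Longrightarrow> erw_op p n (\<lambda>s. (real_of_int s)\<^sup>2) s = (real_of_int s)\<^sup>2 + 1
    + 2 * (2 * p - 1) * (real_of_int s)\<^sup>2 / n"
  by (simp add: erw_op_def srw_op_def field_simps power2_eq_square)

text \<open>
\<open>W n\<close> is the second moment of the walk stopped on leaving the strip.  It increases by
\<open>1 + 2 (2 p - 1) S\<^sub>n\<^sup>2 / n\<close> on the event that the strip has not been left, so the sign of
\<open>2 p - 1\<close> decides how it compares with \<open>\<Sum>k<n. P (k < \<zeta>)\<close>, the mean of \<open>min n \<zeta>\<close>.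
\<close>

lemma stopped_square_bound:
  assumes m: "m > 0"
  defines "W \<equiv> \<lambda>n. (\<integral>\<omega>. of_bool (confined m n \<omega>) * (real_of_int (S n \<omega>))\<^sup>2 \<partial>M)
      + (real m)\<^sup>2 * (1 - confined_prob m n)"
  shows "p \<le> 1/2 \<Longrightarrow> W n \<le> (\<Sum>k<n. confined_prob m k)"
    and "p \<ge> 1/2 \<Longrightarrow> (\<Sum>k<n. confined_prob m k) \<le> W n"
proof -
  let ?c = "\<lambda>n \<omega>. of_bool (confined m n \<omega>) :: real"
  have ci: "integrable M (?c n)" for n by (rule adapted_integrable[OF adapted_of_bool[OF adapted_confined]])
  have W0: "W 0 = 0"
  proof -
    have "(\<integral>\<omega>. ?c 0 \<omega> * (real_of_int (S 0 \<omega>))\<^sup>2 \<partial>M) = (\<integral>\<omega>. 0 \<partial>M)"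
      by (rule Bochner_Integration.integral_cong) (auto simp: S_0)
    then show ?thesis using confined_prob_0[OF m] by (simp add: W_def)
  qed
  have WSuc: "W (Suc n) = (\<integral>\<omega>. ?c n \<omega> * (real_of_int (S (Suc n) \<omega>))\<^sup>2 \<partial>M)
      + (real m)\<^sup>2 * (1 - confined_prob m n)" for n
  proof -
    have sq: "(real_of_int s)\<^sup>2 = (real m)\<^sup>2" if "\<bar>s\<bar> = int m" for s :: int
      by (metis of_int_abs of_int_of_nat_eq power2_abs that)
    show ?thesis unfolding W_def
      by (subst exit_balance[of m "\<lambda>s. (real_of_int s)\<^sup>2", OF sq]) (auto simp: algebra_simps)
  qed
  \<comment> \<open>The operator \<open>erw_op p n\<close> describes the steps from times \<open>n \<ge> 1\<close> only, so the first step is separate.\<close>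
  have W1: "W (Suc 0) = 1"
    unfolding WSuc using confined_prob_0[OF m] expectation_S_1[of m "\<lambda>s. (real_of_int s)\<^sup>2"] m by simp
  define d where "d n = (\<integral>\<omega>. ?c n \<omega> * (2 * (real_of_int (S n \<omega>))\<^sup>2 / n) \<partial>M)" for n
  have d0: "d n \<ge> 0" for n unfolding d_def by (rule Bochner_Integration.integral_nonneg) auto
  have step: "W (Suc n) = W n + confined_prob m n + (2 * p - 1) * d n" if n: "n \<ge> 1" for n
  proof -
    have ad: "adapted n (\<lambda>\<omega>. ?c n \<omega> * f (S n \<omega>))" for f :: "int \<Rightarrow> real"
      by (rule adapted_confined_mult) auto
    have i: "integrable M (\<lambda>\<omega>. ?c n \<omega> * (real_of_int (S n \<omega>))\<^sup>2)"
      "integrable M (\<lambda>\<omega>. ?c n \<omega> * (2 * (real_of_int (S n \<omega>))\<^sup>2 / n))"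
      by (rule adapted_integrable[OF ad[of "\<lambda>s. (real_of_int s)\<^sup>2"]])
         (rule adapted_integrable[OF ad[of "\<lambda>s. 2 * (real_of_int s)\<^sup>2 / n"]])
    have "(\<integral>\<omega>. ?c n \<omega> * (real_of_int (S (Suc n) \<omega>))\<^sup>2 \<partial>M)
       = (\<integral>\<omega>. ?c n \<omega> * (real_of_int (S n \<omega>))\<^sup>2 + ?c n \<omega>
           + (2 * p - 1) * (?c n \<omega> * (2 * (real_of_int (S n \<omega>))\<^sup>2 / n)) \<partial>M)"
      by (subst markov_step[OF adapted_of_bool[OF adapted_confined] n, of _ "\<lambda>s. (real_of_int s)\<^sup>2"])
         (simp add: erw_op_square[OF n] algebra_simps add_divide_distrib diff_divide_distrib)
    also have "\<dots> = (\<integral>\<omega>. ?c n \<omega> * (real_of_int (S n \<omega>))\<^sup>2 \<partial>M) + confined_prob m n + (2 * p - 1) * d n"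
    proof -
      have "(\<integral>\<omega>. A \<omega> + B \<omega> + q * C \<omega> \<partial>M) = (\<integral>\<omega>. A \<omega> \<partial>M) + (\<integral>\<omega>. B \<omega> \<partial>M) + q * (\<integral>\<omega>. C \<omega> \<partial>M)"
        if "integrable M A" "integrable M B" "integrable M C" for A B C :: "'a \<Rightarrow> real" and q
        using that by simp
      from this[OF i(1) ci[of n] i(2)] show ?thesis unfolding confined_prob_def d_def .
    qed
    finally show ?thesis using WSuc[of n] unfolding W_def by linarith
  qed
  have step': "\<exists>e\<ge>0. W (Suc n) = W n + confined_prob m n + (2 * p - 1) * e" for n
  proof (cases "n = 0")
    case True
    then show ?thesis using W0 W1 confined_prob_0[OF m] by (intro exI[of _ 0]) auto
  next
    case False
    then show ?thesis using step[of n] d0[of n] by (intro exI[of _ "d n"]) auto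
  qed
  show "W n \<le> (\<Sum>k<n. confined_prob m k)" if "p \<le> 1/2"
  proof (induction n)
    case (Suc n)
    obtain e where "e \<ge> 0" "W (Suc n) = W n + confined_prob m n + (2 * p - 1) * e" using step' by blast
    moreover have "(2 * p - 1) * e \<le> 0" using that \<open>e \<ge> 0\<close> by (intro mult_nonpos_nonneg) auto
    ultimately show ?case using Suc.IH by simp
  qed (simp add: W0)
  show "(\<Sum>k<n. confined_prob m k) \<le> W n" if "p \<ge> 1/2"
  proof (induction n)
    case (Suc n)
    obtain e where "e \<ge> 0" "W (Suc n) = W n + confined_prob m n + (2 * p - 1) * e" using step' by blast
    moreover have "(2 * p - 1) * e \<ge> 0" using that \<open>e \<ge> 0\<close> by (intro mult_nonneg_nonneg) auto
    ultimately show ?case using Suc.IH by simp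
  qed (simp add: W0)
qed

lemma less_exit_time_iff: "enat n < exit_time S m \<omega> \<longleftrightarrow> confined m n \<omega>"
proof -
  let ?A = "{k. \<bar>S k \<omega>\<bar> \<ge> int m}"
  show ?thesis
  proof (cases "?A = {}")
    case True
    then have "exit_time S m \<omega> = \<infinity>" by (simp only: exit_time_def) (simp add: top_enat_def)
    moreover have "confined m n \<omega>" using True by (auto simp: confined_def not_le)
    ultimately show ?thesis by simp
  next
    case False
    then have "exit_time S m \<omega> \<in> enat ` ?A" unfolding exit_time_def
      by (metis (lifting) wellorder_InfI ex_in_conv image_eqI)
    then obtain t where t: "exit_time S m \<omega> = enat t" "t \<in> ?A" by auto
    have min: "t \<le> k" if "k \<in> ?A" for k
    proof -
      have "exit_time S m \<omega> \<le> enat k" unfolding exit_time_def using that by (intro Inf_lower) auto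
      then show ?thesis using t by simp
    qed
    show ?thesis
    proof
      assume "enat n < exit_time S m \<omega>"
      then have nt: "n < t" using t by simp
      show "confined m n \<omega>" unfolding confined_def
      proof
        fix k assume "k \<in> {..n}"
        then show "\<bar>S k \<omega>\<bar> < int m" using min[of k] nt by (auto simp: not_le[symmetric])
      qed
    next
      assume "confined m n \<omega>"
      then have "\<bar>S t \<omega>\<bar> < int m" if "t \<le> n" using that by (auto simp: confined_def)
      then have "\<not> t \<le> n" using t(2) by auto
      then show "enat n < exit_time S m \<omega>" using t by simp
    qed
  qed
qed

lemma expected_exit_time_eq: "expected_exit_time M S m = (\<Sum>n. ennreal (confined_prob m n))"
proof -
  have "exit_time S m -` {enat n<..} \<inter> space M \<in> sets M" for n
  proof -
    have "exit_time S m -` {enat n<..} \<inter> space M = {\<omega> \<in> space M. confined m n \<omega>}"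
      by (auto simp: less_exit_time_iff)
    then show ?thesis by simp
  qed
  have "exit_time S m -` {t} \<inter> space M \<in> sets M" for t
  proof (cases t)
    case (enat n)
    have "exit_time S m \<omega> = enat n \<longleftrightarrow> \<not> confined m n \<omega> \<and> (\<forall>k\<in>{..<n}. confined m k \<omega>)" for \<omega>
    proof (cases "exit_time S m \<omega>")
      case (enat e)
      have "e = n \<longleftrightarrow> \<not> n < e \<and> (\<forall>k\<in>{..<n}. k < e)"
        by (meson lessThan_iff less_irrefl linorder_neqE_nat)
      then show ?thesis unfolding less_exit_time_iff[symmetric] enat by simp
    qed (simp add: less_exit_time_iff[symmetric])
    then have "exit_time S m -` {t} \<inter> space M
        = {\<omega> \<in> space M. \<not> confined m n \<omega> \<and> (\<forall>k\<in>{..<n}. confined m k \<omega>)}"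
      using enat by auto
    then show ?thesis by simp
  next
    case infinity
    have "exit_time S m \<omega> = \<infinity> \<longleftrightarrow> (\<forall>k. confined m k \<omega>)" for \<omega>
      unfolding less_exit_time_iff[symmetric] by (cases "exit_time S m \<omega>") auto
    then have "exit_time S m -` {t} \<inter> space M = {\<omega> \<in> space M. \<forall>k. confined m k \<omega>}"
      using infinity by auto
    then show ?thesis by simp
  qed
  then have "exit_time S m \<in> measurable M (count_space UNIV)"
    by (subst measurable_count_space_eq_countable) auto
  from nn_integral_enat_function[OF this]
  show ?thesis unfolding expected_exit_time_def less_exit_time_iff confined_prob_eq
    by (simp add: emeasure_eq_measure)
qed

text \<open>
If the expectation is finite, then the walk leaves the strip almost surely, so the stopped second
moment tends to at least \<open>m\<^sup>2\<close>.
\<close>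

lemma expected_exit_time_ge:
  assumes m: "m > 0" and p: "p \<le> 1/2"
  shows "(of_nat m)\<^sup>2 \<le> expected_exit_time M S m"
proof (cases "(\<Sum>n. ennreal (confined_prob m n)) = top")
  case False
  have s: "summable (confined_prob m)"
    by (rule summable_suminf_not_top[OF _ False]) (rule confined_prob_bounds)
  have "(real m)\<^sup>2 * (1 - confined_prob m n) \<le> (\<Sum>k<n. confined_prob m k)" for n
  proof -
    have "0 \<le> (\<integral>\<omega>. of_bool (confined m n \<omega>) * (real_of_int (S n \<omega>))\<^sup>2 \<partial>M)"
      by (rule Bochner_Integration.integral_nonneg) auto
    then show ?thesis using stopped_square_bound(1)[OF m p, of n] by linarith
  qed
  moreover have "(\<lambda>n. (real m)\<^sup>2 * (1 - confined_prob m n)) \<longlonglongrightarrow> (real m)\<^sup>2 * (1 - 0)"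
    by (intro tendsto_intros summable_LIMSEQ_zero s)
  ultimately have "(real m)\<^sup>2 \<le> (\<Sum>n. confined_prob m n)"
    using LIMSEQ_le[of "\<lambda>n. (real m)\<^sup>2 * (1 - confined_prob m n)" _ "\<lambda>n. (\<Sum>k<n. confined_prob m k)"
        "suminf (confined_prob m)"]
      summable_LIMSEQ[OF s] by auto
  then have "ennreal ((real m)\<^sup>2) \<le> ennreal (\<Sum>n. confined_prob m n)" by (rule ennreal_leI)
  also have "\<dots> = expected_exit_time M S m"
    unfolding expected_exit_time_eq by (rule suminf_ennreal[symmetric])
        (use confined_prob_bounds False in auto)
  finally show ?thesis by (simp add: ennreal_power[symmetric] ennreal_of_nat_eq_real_of_nat)
qed (simp add: expected_exit_time_eq)

lemma expected_exit_time_le: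
  assumes m: "m > 0" and p: "p \<ge> 1/2"
  shows "expected_exit_time M S m \<le> (of_nat m)\<^sup>2"
proof -
  have "(\<Sum>k<n. confined_prob m k) \<le> (real m)\<^sup>2" for n
  proof -
    have "(\<integral>\<omega>. of_bool (confined m n \<omega>) * (real_of_int (S n \<omega>))\<^sup>2 \<partial>M)
        \<le> (\<integral>\<omega>. (real m)\<^sup>2 * of_bool (confined m n \<omega>) \<partial>M)"
    proof (rule expectation_mono_AE[of n])
      have "(real_of_int (S n \<omega>))\<^sup>2 \<le> (real m)\<^sup>2" if "confined m n \<omega>" for \<omega>
      proof -
        have "\<bar>S n \<omega>\<bar> < int m" using that by (auto simp: confined_def)
        then have "\<bar>real_of_int (S n \<omega>)\<bar> \<le> \<bar>real m\<bar>" by linarith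
        then show ?thesis by (rule abs_le_square_iff[THEN iffD1])
      qed
      then show "AE \<omega> in M. of_bool (confined m n \<omega>) * (real_of_int (S n \<omega>))\<^sup>2
          \<le> (real m)\<^sup>2 * of_bool (confined m n \<omega>)"
        by (auto simp: of_bool_def)
    qed (auto intro!: adapted_mult adapted_of_bool adapted_confined adapted_confined_mult)
    also have "\<dots> = (real m)\<^sup>2 * confined_prob m n" by (simp add: confined_prob_def)
    finally show ?thesis using stopped_square_bound(2)[OF m p, of n] by (simp add: algebra_simps)
  qed
  then have "(\<Sum>k<n. ennreal (confined_prob m k)) \<le> ennreal ((real m)\<^sup>2)" for n
    by (subst sum_ennreal) (auto simp: confined_prob_bounds intro!: ennreal_leI)
  then have "(\<Sum>n. ennreal (confined_prob m n)) \<le> ennreal ((real m)\<^sup>2)"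
    unfolding suminf_eq_SUP by (rule SUP_least)
  then show ?thesis
    by (simp add: expected_exit_time_eq ennreal_power[symmetric] ennreal_of_nat_eq_real_of_nat)
qed

end

section \<open>Recurrence\<close>

text \<open>
The probability that a simple random walk started at \<open>s\<close> stays away from \<open>0\<close> during its first
\<open>j\<close> steps.
\<close>

fun killed_srw :: "nat \<Rightarrow> int \<Rightarrow> real" where
  "killed_srw 0 s = of_bool (s \<noteq> 0)"
| "killed_srw (Suc j) s = (if s = 0 then 0 else srw_op (killed_srw j) s)"

lemma killed_srw_0 [simp]: "killed_srw j 0 = 0"
  by (cases j) auto

lemma killed_srw_bounds: "0 \<le> killed_srw j s \<and> killed_srw j s \<le> 1"
proof (induction j arbitrary: s)
  case (Suc j)
  show ?case using Suc.IH[of "s + 1"] Suc.IH[of "s - 1"] by (auto simp: srw_op_def)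
qed auto

lemma killed_srw_radially_monotone: "radially_monotone 1 (killed_srw j)"
proof (induction j)
  case 0 show ?case by (auto simp: radially_monotone_def)
next
  case (Suc j)
  have rm: "radially_monotone 1 (srw_op (killed_srw j))"
    by (rule srw_op_radially_monotone[OF Suc.IH])
  have "0 \<le> killed_srw (Suc j) (k + 2) - killed_srw (Suc j) k" if "k \<ge> 0" for k
  proof (cases "k = 0")
    case True
    then show ?thesis using killed_srw_bounds[of "Suc j" 2] by simp
  next
    case False
    then have "0 \<le> srw_op (killed_srw j) (k + 2) - srw_op (killed_srw j) k"
      using rm that by (auto simp: radially_monotone_def)
    then show ?thesis using False that by simp
  qed
  then show ?case using rm by (auto simp: radially_monotone_def)
qed

lemma killed_srw_decreasing: "killed_srw (Suc j) s \<le> killed_srw j s"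
proof (induction j arbitrary: s)
  case 0
  show ?case using killed_srw_bounds[of 1 s] by auto
next
  case (Suc j)
  have "srw_op (killed_srw (Suc j)) s \<le> srw_op (killed_srw j) s"
    unfolding srw_op_def by (intro divide_right_mono add_mono Suc.IH) simp
  then show ?case by (simp only: killed_srw.simps) simp
qed

text \<open>
The decreasing limit is harmonic off the origin and vanishes there, hence is linear on the
nonnegative half-line; being bounded, it is \<open>0\<close>.
\<close>

lemma killed_srw_tendsto_0: "(\<lambda>j. killed_srw j s) \<longlonglongrightarrow> 0"
proof -
  have "\<exists>L. (\<lambda>j. killed_srw j s) \<longlonglongrightarrow> L" for s
    using decseq_convergent[of "\<lambda>j. killed_srw j s" 0] killed_srw_decreasing killed_srw_bounds
    by (metis decseq_SucI)
  then obtain v where v: "\<And>s. (\<lambda>j. killed_srw j s) \<longlonglongrightarrow> v s" by metis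
  have v0: "v 0 = 0" using v[of 0] by (simp add: LIMSEQ_const_iff)
  have harm: "v s = (v (s + 1) + v (s - 1)) / 2" if "s \<noteq> 0" for s
  proof (rule LIMSEQ_unique)
    show "(\<lambda>j. killed_srw (Suc j) s) \<longlonglongrightarrow> v s" by (rule LIMSEQ_Suc[OF v])
    show "(\<lambda>j. killed_srw (Suc j) s) \<longlonglongrightarrow> (v (s + 1) + v (s - 1)) / 2"
      using that by (simp add: srw_op_def) (intro tendsto_intros v; simp)
  qed
  have lin: "v (int k) = k * v 1 \<and> v (int (Suc k)) = Suc k * v 1" for k
  proof (induction k)
    case (Suc k)
    have "v (int (Suc k)) = (v (int (Suc k) + 1) + v (int (Suc k) - 1)) / 2" by (rule harm) simp
    moreover have "int (Suc k) + 1 = int (Suc (Suc k))" "int (Suc k) - 1 = int k" by simp_all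
    ultimately have "v (int (Suc (Suc k))) = 2 * v (int (Suc k)) - v (int k)" by (simp del: of_nat_Suc)
    then show ?case using Suc.IH by (simp add: algebra_simps)
  qed (simp add: v0)
  have v1: "v s \<le> 1" "0 \<le> v s" for s
    using killed_srw_bounds by (auto intro!: LIMSEQ_le_const2[OF v] LIMSEQ_le_const[OF v])
  have "v 1 = 0"
  proof (rule ccontr)
    assume "v 1 \<noteq> 0"
    then have "v 1 > 0" using v1(2)[of 1] by simp
    then obtain k where "1 < real k * v 1" using reals_Archimedean3 by blast
    then show False using lin[of k] v1(1)[of "int k"] by simp
  qed
  moreover have "v (- s) = v s" for s
    using v[of s] v[of "- s"] killed_srw_radially_monotone LIMSEQ_unique
    unfolding radially_monotone_def by auto
  ultimately have "v s = 0"
    using lin[of "nat \<bar>s\<bar>"] by (cases "s \<ge> 0") auto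
  then show ?thesis using v[of s] by simp
qed

context elephant_random_walk
begin

definition avoids :: "int \<Rightarrow> nat \<Rightarrow> 'a \<Rightarrow> bool" where
  "avoids x N \<omega> \<longleftrightarrow> (\<forall>n\<ge>N. S n \<omega> \<noteq> x)"

lemma avoids_pred [measurable]: "Measurable.pred M (avoids x N)"
  unfolding avoids_def[abs_def] by measurable

lemma avoids_unfold: "avoids x N \<omega> \<longleftrightarrow> S N \<omega> \<noteq> x \<and> avoids x (Suc N) \<omega>"
  unfolding avoids_def by (metis Suc_leD le_refl not_less_eq_eq antisym)

text \<open>
From time \<open>N\<^sub>0\<close> on, the conditional probability given the past that \<open>x\<close> is never visited again is at
most \<open>f\<close> of the current position; the weights \<open>g\<close> express the conditioning.
\<close>

definition avoidance_bound :: "int \<Rightarrow> nat \<Rightarrow> (int \<Rightarrow> real) \<Rightarrow> bool" where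
  "avoidance_bound x N0 f \<longleftrightarrow> (\<forall>N\<ge>N0. \<forall>g. adapted N g \<longrightarrow> (\<forall>\<omega>. 0 \<le> g \<omega>) \<longrightarrow>
     (\<integral>\<omega>. g \<omega> * of_bool (avoids x N \<omega>) \<partial>M) \<le> (\<integral>\<omega>. g \<omega> * f (S N \<omega>) \<partial>M))"

lemma avoidance_boundD:
  "avoidance_bound x N0 f \<Longrightarrow> N0 \<le> N \<Longrightarrow> adapted N g \<Longrightarrow> (\<And>\<omega>. 0 \<le> g \<omega>) \<Longrightarrow>
     (\<integral>\<omega>. g \<omega> * of_bool (avoids x N \<omega>) \<partial>M) \<le> (\<integral>\<omega>. g \<omega> * f (S N \<omega>) \<partial>M)"
  unfolding avoidance_bound_def by blast

lemma integrable_mult_of_bool: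
  assumes "integrable M g" "Measurable.pred M P"
  shows "integrable M (\<lambda>\<omega>. g \<omega> * of_bool (P \<omega>) :: real)"
proof -
  have [measurable]: "Measurable.pred M P" "g \<in> borel_measurable M" using assms by auto
  show ?thesis using assms(1) by (rule Bochner_Integration.integrable_bound) auto
qed

lemma avoidance_bound_one: "avoidance_bound x N0 (\<lambda>_. 1)"
  unfolding avoidance_bound_def
proof (intro allI impI)
  fix N and g :: "'a \<Rightarrow> real" assume g: "adapted N g" "\<forall>\<omega>. 0 \<le> g \<omega>"
  show "(\<integral>\<omega>. g \<omega> * of_bool (avoids x N \<omega>) \<partial>M) \<le> (\<integral>\<omega>. g \<omega> * 1 \<partial>M)"
    by (rule integral_mono)
       (use g in \<open>auto intro!: integrable_mult_of_bool[OF adapted_integrable[OF g(1)] avoids_pred]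
          adapted_integrable[OF g(1)]\<close>)
qed

text \<open>
A bound may be lowered to \<open>0\<close> at \<open>x\<close> itself, and elsewhere to its mean after one step, because
avoiding \<open>x\<close> from now on means avoiding it now and from the next time on.
\<close>

lemma avoidance_bound_improve:
  assumes f: "avoidance_bound x N0 f" and N0: "N0 \<ge> 1"
    and h: "\<And>s. f s \<le> h s \<or> (s = x \<and> 0 \<le> h s) \<or> (s \<noteq> x \<and> (\<forall>N\<ge>N0. erw_op p N f s \<le> h s))"
  shows "avoidance_bound x N0 h"
  unfolding avoidance_bound_def
proof (intro allI impI)
  fix N and g :: "'a \<Rightarrow> real"
  assume N: "N0 \<le> N" and g: "adapted N g" "\<forall>\<omega>. 0 \<le> g \<omega>"
  define g1 where "g1 \<omega> = g \<omega> * of_bool (f (S N \<omega>) \<le> h (S N \<omega>))" for \<omega>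
  define g2 where "g2 \<omega> = g \<omega> * of_bool (\<not> f (S N \<omega>) \<le> h (S N \<omega>))" for \<omega>
  define g3 where "g3 \<omega> = g2 \<omega> * of_bool (S N \<omega> \<noteq> x)" for \<omega>
  have ad: "adapted N g1" "adapted N g2"
    unfolding g1_def[abs_def] g2_def[abs_def]
    by (intro adapted_mult g adapted_of_bool adapted_fun_S[of N N "\<lambda>s. f s
        \<le> h s"] adapted_fun_S[of N N "\<lambda>s. \<not> f s \<le> h s"]; simp)+
  then have ad3: "adapted N g3" unfolding g3_def[abs_def]
    by (intro adapted_mult adapted_of_bool adapted_fun_S[of N N "\<lambda>s. s \<noteq> x"]) auto
  have nn: "0 \<le> g1 \<omega>" "0 \<le> g2 \<omega>" "0 \<le> g3 \<omega>" for \<omega>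
    using g by (auto simp: g1_def g2_def g3_def)
  have adF: "adapted N (\<lambda>\<omega>. k \<omega> * F (S N \<omega>))" if "adapted N k" for k and F :: "int \<Rightarrow> real"
    using that by (intro adapted_mult adapted_fun_S) auto
  have g12: "g \<omega> = g1 \<omega> + g2 \<omega>" for \<omega> by (auto simp: g1_def g2_def)
  have "(\<integral>\<omega>. g1 \<omega> * of_bool (avoids x N \<omega>) \<partial>M) \<le> (\<integral>\<omega>. g1 \<omega> * f (S N \<omega>) \<partial>M)"
    by (rule avoidance_boundD[OF f N ad(1)]) (rule nn)
  also have "\<dots> \<le> (\<integral>\<omega>. g1 \<omega> * h (S N \<omega>) \<partial>M)"
  proof (rule expectation_mono_AE[of N])
    show "AE \<omega> in M. g1 \<omega> * f (S N \<omega>) \<le> g1 \<omega> * h (S N \<omega>)"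
      using g(2) by (auto simp: g1_def of_bool_def intro!: mult_left_mono)
  qed (auto intro!: adF ad)
  finally have 1: "(\<integral>\<omega>. g1 \<omega> * of_bool (avoids x N \<omega>) \<partial>M) \<le> (\<integral>\<omega>. g1 \<omega> * h (S N \<omega>) \<partial>M)" .
  have "(\<integral>\<omega>. g2 \<omega> * of_bool (avoids x N \<omega>) \<partial>M) = (\<integral>\<omega>. g3 \<omega> * of_bool (avoids x (Suc N) \<omega>) \<partial>M)"
    by (rule Bochner_Integration.integral_cong) (auto simp: g3_def avoids_unfold[of x N])
  also have "\<dots> \<le> (\<integral>\<omega>. g3 \<omega> * f (S (Suc N) \<omega>) \<partial>M)"
    by (rule avoidance_boundD[OF f _ adapted_mono[OF ad3]]) (use N nn in auto)
  also have "\<dots> = (\<integral>\<omega>. g3 \<omega> * erw_op p N f (S N \<omega>) \<partial>M)"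
    by (rule markov_step[OF ad3]) (use N N0 in simp)
  also have "\<dots> \<le> (\<integral>\<omega>. g2 \<omega> * h (S N \<omega>) \<partial>M)"
  proof (rule expectation_mono_AE[of N])
    have "g3 \<omega> * erw_op p N f (S N \<omega>) \<le> g2 \<omega> * h (S N \<omega>)" for \<omega>
    proof (cases "f (S N \<omega>) \<le> h (S N \<omega>)")
      case False
      then show ?thesis using h[of "S N \<omega>"] N nn(2)[of \<omega>] by (auto simp: g3_def intro: mult_left_mono)
    qed (simp add: g2_def g3_def)
    then show "AE \<omega> in M. g3 \<omega> * erw_op p N f (S N \<omega>) \<le> g2 \<omega> * h (S N \<omega>)" by simp
  qed (auto intro!: adF ad ad3)
  finally have 2: "(\<integral>\<omega>. g2 \<omega> * of_bool (avoids x N \<omega>) \<partial>M) \<le> (\<integral>\<omega>. g2 \<omega> * h (S N \<omega>) \<partial>M)" .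
  have "(\<integral>\<omega>. g \<omega> * of_bool (avoids x N \<omega>) \<partial>M)
      = (\<integral>\<omega>. g1 \<omega> * of_bool (avoids x N \<omega>) \<partial>M) + (\<integral>\<omega>. g2 \<omega> * of_bool (avoids x N \<omega>) \<partial>M)"
    unfolding g12 distrib_right
    by (intro Bochner_Integration.integral_add integrable_mult_of_bool adapted_integrable[OF ad(1)]
        adapted_integrable[OF ad(2)] avoids_pred)
  also have "\<dots> \<le> (\<integral>\<omega>. g1 \<omega> * h (S N \<omega>) \<partial>M) + (\<integral>\<omega>. g2 \<omega> * h (S N \<omega>) \<partial>M)"
    using 1 2 by (rule add_mono)
  also have "\<dots> = (\<integral>\<omega>. g \<omega> * h (S N \<omega>) \<partial>M)"
    unfolding g12 distrib_right
    by (intro Bochner_Integration.integral_add[symmetric] adapted_integrable[OF adF[OF ad(1)]]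
        adapted_integrable[OF adF[OF ad(2)]])
  finally show "(\<integral>\<omega>. g \<omega> * of_bool (avoids x N \<omega>) \<partial>M) \<le> (\<integral>\<omega>. g \<omega> * h (S N \<omega>) \<partial>M)" .
qed

text \<open>
Backwards along the straight path from \<open>0\<close> to \<open>x\<close>, each step costs a factor \<open>1/4\<close>: at times
\<open>N \<ge> 2 |x|\<close> and positions \<open>|s| \<le> |x|\<close>, the step towards \<open>x\<close> has probability at least \<open>1/4\<close>.
\<close>

lemma avoidance_bound_at_0:
  assumes a: "avoidance_bound x N0 (\<lambda>_. \<alpha>)" "0 \<le> \<alpha>"
    and N0: "N0 \<ge> 1" "int N0 \<ge> 2 * \<bar>x\<bar>"
  shows "avoidance_bound x N0 (\<lambda>s. \<alpha> * (1 - (1/4) ^ nat \<bar>x\<bar> * of_bool (s = 0)))"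
proof -
  \<comment> \<open>The path is parametrised by the number \<open>i\<close> of steps that remain to \<open>x\<close>.\<close>
  define F where "F i s = \<alpha> * (1 - (1/4) ^ i * of_bool (s = x - sgn x * int i))" for i s
  have "avoidance_bound x N0 (F i)" if "int i \<le> \<bar>x\<bar>" for i
    using that
  proof (induction i)
    case 0
    show ?case
      by (rule avoidance_bound_improve[OF a(1) N0(1)]) (auto simp: F_def of_bool_def)
  next
    case (Suc i)
    show ?case
    proof (rule avoidance_bound_improve[OF _ N0(1)])
      show "avoidance_bound x N0 (F i)" using Suc by simp
      fix s
      define d where "d = sgn x"
      have d: "d = 1 \<or> d = -1" "x = d * \<bar>x\<bar>" "x \<noteq> 0" using Suc.prems by (auto simp: d_def sgn_if)
      show "F i s \<le> F (Suc i) s \<or> s = x \<and> 0 \<le> F (Suc i) s \<or> s \<noteq> x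
          \<and> (\<forall>N\<ge>N0. erw_op p N (F i) s \<le> F (Suc i) s)"
      proof (cases "s = x - d * int (Suc i)")
        case False
        then have "F (Suc i) s = \<alpha> * 1" by (simp add: F_def d_def)
        then have "F i s \<le> F (Suc i) s"
          unfolding F_def by (simp only: F_def) (intro mult_left_mono a(2), simp)
        then show ?thesis by simp
      next
        case True
        have sx: "s \<noteq> x" using True d by auto
        have "\<bar>s\<bar> \<le> \<bar>x\<bar>"
        proof -
          have "s = d * (\<bar>x\<bar> - int (Suc i))" using True d(2) by (simp add: algebra_simps)
          then show ?thesis using d(1) Suc.prems by (auto simp: abs_mult)
        qed
        have "erw_op p N (F i) s \<le> F (Suc i) s" if "N \<ge> N0" for N
        proof -
          have N: "real N \<ge> 2 * \<bar>real_of_int s\<bar>" "real N \<ge> 1"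
          proof -
            have "2 * \<bar>s\<bar> \<le> int N" using that N0 \<open>\<bar>s\<bar> \<le> \<bar>x\<bar>\<close> by linarith
            then show "real N \<ge> 2 * \<bar>real_of_int s\<bar>" by linarith
          qed (use that N0 in simp)
          have near: "F i (s + d) = \<alpha> * (1 - (1/4) ^ i)"
            using True by (simp add: F_def d_def algebra_simps)
          have far: "F i (s - d) = \<alpha>"
            using True d(1) by (auto simp: F_def d_def[symmetric] algebra_simps)
          define e where "e = (2 * p - 1) * (real_of_int d * real_of_int s) / (2 * real N)"
          have erw: "erw_op p N (F i) s = (F i (s + d) + F i (s - d)) / 2 + e * (F i (s + d) - F i (s - d))"
            using d(1) by (auto simp: erw_op_def srw_op_def e_def field_simps)
          have "\<bar>e\<bar> \<le> 1/4"
          proof -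
            have "\<bar>2 * p - 1\<bar> * \<bar>real_of_int s\<bar> \<le> 1 * \<bar>real_of_int s\<bar>"
              using p_range by (intro mult_right_mono) auto
            then have "\<bar>2 * p - 1\<bar> * \<bar>real_of_int s\<bar> \<le> real N / 2" using N by linarith
            moreover have "\<bar>e\<bar> = \<bar>2 * p - 1\<bar> * \<bar>real_of_int s\<bar> / (2 * real N)"
              using d(1) by (auto simp: e_def abs_mult)
            ultimately have "\<bar>e\<bar> \<le> (real N / 2) / (2 * real N)"
              by (simp only:) (intro divide_right_mono, auto)
            then show ?thesis using N(2) by simp
          qed
          then have "1/4 \<le> 1/2 + e" by linarith
          then have "\<alpha> * (1/4) ^ i * (1/4) \<le> \<alpha> * (1/4) ^ i * (1/2 + e)"
            using a(2) by (intro mult_left_mono) auto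
          moreover have "erw_op p N (F i) s = \<alpha> - \<alpha> * (1/4) ^ i * (1/2 + e)"
            unfolding erw near far by (simp add: field_simps)
          moreover have "F (Suc i) s = \<alpha> - \<alpha> * (1/4) ^ i * (1/4)"
            using True by (simp add: F_def d_def algebra_simps)
          ultimately show ?thesis by linarith
        qed
        then show ?thesis using sx by simp
      qed
    qed
  qed
  from this[of "nat \<bar>x\<bar>"] have "avoidance_bound x N0 (F (nat \<bar>x\<bar>))" by simp
  moreover have "F (nat \<bar>x\<bar>) = (\<lambda>s. \<alpha> * (1 - (1/4) ^ nat \<bar>x\<bar> * of_bool (s = 0)))"
    unfolding F_def by (auto simp: sgn_mult_abs)
  ultimately show ?thesis by simp
qed

text \<open>
Before the simple walk would have reached the origin, the bound is \<open>\<alpha>\<close>, and afterwards it is the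
improved value at the origin.  The probability of the former tends to \<open>0\<close> with the number of
steps that are looked ahead.
\<close>

lemma avoidance_bound_contract:
  assumes p: "p \<le> 1/2"
    and a: "avoidance_bound x N0 (\<lambda>_. \<alpha>)" "0 \<le> \<alpha>"
    and N0: "N0 \<ge> 1" "int N0 \<ge> 2 * \<bar>x\<bar>"
  shows "avoidance_bound x N0 (\<lambda>_. \<alpha> * (1 - (1/4) ^ nat \<bar>x\<bar>))"
proof -
  define c :: real where "c = (1/4) ^ nat \<bar>x\<bar>"
  have c: "0 < c" "c \<le> 1" by (auto simp: c_def power_le_one)
  define F where "F j s = \<alpha> * (1 - c) + (\<alpha> * c) * killed_srw j s" for j s
  have B: "avoidance_bound x N0 (F j)" for j
  proof (induction j)
    case 0
    have "F 0 = (\<lambda>s. \<alpha> * (1 - c * of_bool (s = 0)))"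
      by (auto simp: F_def fun_eq_iff of_bool_def algebra_simps)
    then show ?case using avoidance_bound_at_0[OF a N0] by (simp add: c_def)
  next
    case (Suc j)
    show ?case
    proof (rule avoidance_bound_improve[OF Suc.IH N0(1)])
      fix s
      have nn: "0 \<le> F (Suc j) s"
        unfolding F_def using a(2) c killed_srw_bounds
        by (intro add_nonneg_nonneg mult_nonneg_nonneg) (auto simp del: killed_srw.simps)
      have "erw_op p N (F j) s \<le> F (Suc j) s" if "s \<noteq> 0" for N
      proof -
        have "F j = (\<lambda>s. \<alpha> * (1 - c) + (\<alpha> * c) * killed_srw j s)" by (auto simp: F_def)
        then have "erw_op p N (F j) s = \<alpha> * (1 - c) + (\<alpha> * c) * erw_op p N (killed_srw j) s"
          by (simp only: erw_op_affine)
        also have "\<dots> \<le> \<alpha> * (1 - c) + (\<alpha> * c) * srw_op (killed_srw j) s"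
          using a(2) c by (intro add_left_mono mult_left_mono erw_op_le_srw_op p
              killed_srw_radially_monotone) auto
        finally show ?thesis using that by (simp add: F_def)
      qed
      then show "F j s \<le> F (Suc j) s \<or> s = x \<and> 0 \<le> F (Suc j) s \<or> s \<noteq> x
          \<and> (\<forall>N\<ge>N0. erw_op p N (F j) s \<le> F (Suc j) s)"
        using nn by (cases "s = 0") (auto simp: F_def)
    qed
  qed
  show ?thesis
    unfolding avoidance_bound_def c_def[symmetric]
  proof (intro allI impI)
    fix N and g :: "'a \<Rightarrow> real"
    assume N: "N0 \<le> N" and g: "adapted N g" "\<forall>\<omega>. 0 \<le> g \<omega>"
    have ad: "adapted N (\<lambda>\<omega>. g \<omega> * f (S N \<omega>))" for f :: "int \<Rightarrow> real"
      by (intro adapted_mult g adapted_fun_S) simp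
    have "(\<lambda>j. \<integral>\<omega>. g \<omega> * F j (S N \<omega>) \<partial>M) \<longlonglongrightarrow> (\<integral>\<omega>. g \<omega> * (\<alpha> * (1 - c)) \<partial>M)"
    proof (rule integral_dominated_convergence[where w = "\<lambda>\<omega>. g \<omega> * \<alpha>"])
      show "(\<lambda>\<omega>. g \<omega> * F j (S N \<omega>)) \<in> borel_measurable M" for j
        by (rule adapted_borel_measurable[OF ad])
      show "(\<lambda>\<omega>. g \<omega> * (\<alpha> * (1 - c))) \<in> borel_measurable M"
        by (rule adapted_borel_measurable[OF ad[of "\<lambda>_. \<alpha> * (1 - c)"]])
      show "integrable M (\<lambda>\<omega>. g \<omega> * \<alpha>)"
        by (rule adapted_integrable[OF ad[of "\<lambda>_. \<alpha>"]])
      have "(\<lambda>j. F j s) \<longlonglongrightarrow> \<alpha> * (1 - c) + (\<alpha> * c) * 0" for s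
        unfolding F_def by (intro tendsto_intros killed_srw_tendsto_0)
      then show "AE \<omega> in M. (\<lambda>j. g \<omega> * F j (S N \<omega>)) \<longlonglongrightarrow> g \<omega> * (\<alpha> * (1 - c))"
        by (auto intro!: tendsto_intros)
      have "\<bar>F j s\<bar> \<le> \<alpha>" for j s
      proof -
        have "0 \<le> F j s"
          unfolding F_def using a(2) c killed_srw_bounds
              by (intro add_nonneg_nonneg mult_nonneg_nonneg) auto
        moreover have "F j s \<le> \<alpha> * (1 - c) + (\<alpha> * c) * 1"
          unfolding F_def using a(2) c killed_srw_bounds by (intro add_left_mono mult_left_mono) auto
        ultimately show ?thesis by (simp add: algebra_simps)
      qed
      then show "AE \<omega> in M. norm (g \<omega> * F j (S N \<omega>)) \<le> g \<omega> * \<alpha>" for j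
        using g(2) by (auto simp: abs_mult intro!: mult_left_mono)
    qed
    moreover have "(\<integral>\<omega>. g \<omega> * of_bool (avoids x N \<omega>) \<partial>M) \<le> (\<integral>\<omega>. g \<omega> * F j (S N \<omega>) \<partial>M)" for j
      by (rule avoidance_boundD[OF B N g(1)]) (use g(2) in blast)
    ultimately show "(\<integral>\<omega>. g \<omega> * of_bool (avoids x N \<omega>) \<partial>M) \<le> (\<integral>\<omega>. g \<omega> * (\<alpha> * (1 - c)) \<partial>M)"
      by (intro LIMSEQ_le_const) auto
  qed
qed

lemma recurrent_if_p_le_half:
  assumes p: "p \<le> 1/2"
  shows "recurrent M S"
  unfolding recurrent_def
proof
  fix x
  define c :: real where "c = (1/4) ^ nat \<bar>x\<bar>"
  have c: "0 < c" "c \<le> 1" by (auto simp: c_def power_le_one)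
  \<comment> \<open>At least \<open>1\<close> because the Markov property starts with the second step.\<close>
  define N0 where "N0 = nat (2 * \<bar>x\<bar>) + 1"
  have N0: "N0 \<ge> 1" "int N0 \<ge> 2 * \<bar>x\<bar>" by (auto simp: N0_def)
  have B: "avoidance_bound x N0 (\<lambda>_. (1 - c) ^ i)" for i
  proof (induction i)
    case 0 show ?case using avoidance_bound_one by simp
  next
    case (Suc i)
    from avoidance_bound_contract[OF p this _ N0] show ?case
      using c by (simp add: c_def[symmetric] mult.commute)
  qed
  have zero: "AE \<omega> in M. \<not> avoids x N \<omega>" if "N \<ge> N0" for N
  proof -
    have "(\<integral>\<omega>. 1 * of_bool (avoids x N \<omega>) \<partial>M) \<le> (\<integral>\<omega>. 1 * (1 - c) ^ i \<partial>M)" for i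
      by (rule avoidance_boundD[OF B that]) auto
    then have "(\<integral>\<omega>. of_bool (avoids x N \<omega>) \<partial>M) \<le> (1 - c) ^ i" for i
      by (simp add: prob_space)
    moreover have "(\<lambda>i. (1 - c) ^ i) \<longlonglongrightarrow> 0"
      using c by (intro LIMSEQ_power_zero) auto
    ultimately have "(\<integral>\<omega>. of_bool (avoids x N \<omega>) \<partial>M) \<le> (0::real)"
      by (intro LIMSEQ_le_const) auto
    moreover have "(\<integral>\<omega>. of_bool (avoids x N \<omega>) \<partial>M) \<ge> (0::real)"
      by (rule Bochner_Integration.integral_nonneg) auto
    moreover have "integrable M (\<lambda>\<omega>. of_bool (avoids x N \<omega>) :: real)"
      using integrable_mult_of_bool[of "\<lambda>_. 1" "avoids x N"] by simp
    ultimately have "AE \<omega> in M. of_bool (avoids x N \<omega>) = (0::real)"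
      by (subst integral_nonneg_eq_0_iff_AE[symmetric]) auto
    then show ?thesis by eventually_elim auto
  qed
  then have "AE \<omega> in M. \<forall>N\<in>{N0..}. \<not> avoids x N \<omega>"
    by (subst AE_ball_countable) auto
  then have "AE \<omega> in M. \<exists>\<^sub>\<infinity>n. S n \<omega> = x"
  proof eventually_elim
    case (elim \<omega>)
    show ?case unfolding INFM_nat_le
    proof
      fix m
      have "\<not> avoids x (max m N0) \<omega>" using elim by auto
      then show "\<exists>n\<ge>m. S n \<omega> = x" unfolding avoids_def by auto
    qed
  qed
  moreover have "{\<omega> \<in> space M. \<exists>\<^sub>\<infinity>n. S n \<omega> = x} \<in> sets M"
    unfolding INFM_nat_le by measurable
  ultimately show "\<P>(\<omega> in M. \<exists>\<^sub>\<infinity>n. S n \<omega> = x) = 1"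
    by (subst prob_Collect_eq_1) auto
qed

end

section \<open>Upper bound in the law of the iterated logarithm\<close>

text \<open>
This is Hoeffding's bound for the moment generating function of a fair sign.
\<close>

lemma cosh_le_exp_half_square:
  fixes x :: real assumes "x > 0"
  shows "cosh x \<le> exp (x\<^sup>2 / 2)"
proof -
  \<comment> \<open>Hoeffding's lemma for the fair distribution on \<open>{0, 1}\<close>, at twice the argument.\<close>
  have "- (2 * x) * (1/2) + ln (1 + (1/2) * (exp (2 * x) - 1)) \<le> (2 * x)\<^sup>2 / 8"
    by (rule Hoeffdings_lemma_aux) (use assms in auto)
  then have "ln ((1 + exp (2 * x)) / 2) \<le> x\<^sup>2 / 2 + x"
    by (simp add: field_simps power2_eq_square)
  then have "exp (ln ((1 + exp (2 * x)) / 2)) \<le> exp (x\<^sup>2 / 2 + x)"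
    by simp
  then have "(1 + exp (2 * x)) / 2 \<le> exp (x\<^sup>2 / 2 + x)"
    by (subst (asm) exp_ln) (auto intro: add_pos_pos)
  moreover have "cosh x = exp (- x) * ((1 + exp (2 * x)) / 2)"
    by (simp add: cosh_field_def field_simps exp_minus flip: exp_add)
  ultimately have "cosh x \<le> exp (- x) * exp (x\<^sup>2 / 2 + x)"
    by (simp only: mult_left_mono exp_ge_zero)
  then show ?thesis by (simp flip: exp_add)
qed

definition lil_scale :: "real \<Rightarrow> real" where
  "lil_scale t = sqrt (2 * t * ln (ln t))"

lemma lil_scale_mono:
  assumes "exp 1 \<le> s" "s \<le> t" shows "lil_scale s \<le> lil_scale t"
proof -
  have s: "s > 0" using assms(1) exp_gt_zero[of "1::real"] by linarith
  have 1: "1 \<le> ln s" using assms(1) s by (subst ln_ge_iff) auto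
  moreover have "ln s \<le> ln t" using assms s by simp
  ultimately have "0 \<le> ln (ln s)" "ln (ln s) \<le> ln (ln t)" by auto
  then show ?thesis unfolding lil_scale_def
    using s assms by (intro real_sqrt_le_mono mult_mono) auto
qed

context elephant_random_walk
begin

text \<open>
\<open>cosh (\<lambda> S\<^sub>n) / (cosh \<lambda>)\<^sup>n\<close> is a supermartingale: \<open>cosh \<lambda>\<close> is the exact growth rate for the simple
walk, and the inward drift contributes a multiple of \<open>(2 p - 1) S\<^sub>n sinh (\<lambda> S\<^sub>n) \<le> 0\<close>.
Stopping it at height \<open>m = \<lceil>x\<rceil>\<close> and taking \<open>\<lambda> = x / n\<close> gives the Gaussian bound.
\<close>

lemma maximal_inequality:
  assumes p: "p \<le> 1/2" and n: "n \<ge> 1" and x: "x > 0"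
  shows "\<P>(\<omega> in M. \<exists>k\<le>n. x \<le> \<bar>real_of_int (S k \<omega>)\<bar>) \<le> 2 * exp (- x\<^sup>2 / (2 * n))"
proof -
  define m where "m = nat \<lceil>x\<rceil>"
  have m: "m > 0" "x \<le> real m" using x by (auto simp: m_def)
  \<comment> \<open>This minimises the exponent \<open>n l\<^sup>2 / 2 - l x\<close>.\<close>
  define l where "l = x / n"
  have l: "l > 0" using x n by (simp add: l_def)
  define f where "f s = cosh (l * real_of_int s)" for s :: int
  define y where "y = cosh (l * real m)"
  let ?c = "\<lambda>n \<omega>. of_bool (confined m n \<omega>) :: real"
  define u where "u k = (\<integral>\<omega>. ?c k \<omega> * f (S k \<omega>) \<partial>M)" for k
  have u0: "u k \<ge> 0" for k unfolding u_def f_def by (rule Bochner_Integration.integral_nonneg) auto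
  have fy: "f s = y" if "\<bar>s\<bar> = int m" for s
  proof -
    have "cosh (l * real_of_int s) = cosh \<bar>l * real_of_int s\<bar>" by simp
    also have "\<bar>l * real_of_int s\<bar> = l * real m" using that l by (simp add: abs_mult flip: of_int_abs)
    finally show ?thesis by (simp add: f_def y_def)
  qed
  have drift: "erw_op p k f s \<le> cosh l * f s" for k s
  proof -
    have "srw_op f s = cosh l * f s" "f (s + 1) - f (s - 1) = 2 * (sinh l * sinh (l * s))"
      by (simp_all add: srw_op_def f_def distrib_left right_diff_distrib cosh_add cosh_diff)
    then have "erw_op p k f s = cosh l * f s + (2 * p - 1) * (s * sinh (l * s)) * (sinh l / k)"
      unfolding erw_op_def by simp
    moreover have "0 \<le> s * sinh (l * s)"
      using l by (cases "s \<ge> 0") (auto intro!: mult_nonneg_nonneg mult_nonpos_nonpos simp: mult_le_0_iff)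
    then have "(2 * p - 1) * (s * sinh (l * s)) * (sinh l / k) \<le> 0"
      using p l by (intro mult_nonpos_nonneg) auto
    ultimately show ?thesis by simp
  qed
  have WSuc: "u (Suc k) + y * (1 - confined_prob m (Suc k)) = (\<integral>\<omega>. ?c k \<omega> * f (S (Suc k) \<omega>) \<partial>M)
      + y * (1 - confined_prob m k)" for k
    unfolding u_def by (subst exit_balance[of m f, OF fy]) (auto simp: algebra_simps)
  have c1: "cosh l \<ge> 1" by (rule cosh_real_ge_1)
  have W: "u k + y * (1 - confined_prob m k) \<le> cosh l ^ k" if "k \<ge> 1" for k
    using that
  proof (induction k rule: nat_induct_at_least)
    case base
    show ?case using WSuc[of 0] expectation_S_1[of m f] m confined_prob_0[OF m(1)] by (simp add: f_def)
  next
    case (Suc k)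
    have "(\<integral>\<omega>. ?c k \<omega> * f (S (Suc k) \<omega>) \<partial>M) = (\<integral>\<omega>. ?c k \<omega> * erw_op p k f (S k \<omega>) \<partial>M)"
      by (rule markov_step[OF adapted_of_bool[OF adapted_confined] Suc.hyps])
    also have "\<dots> \<le> (\<integral>\<omega>. cosh l * (?c k \<omega> * f (S k \<omega>)) \<partial>M)"
    proof (rule expectation_mono_AE[of k])
      show "AE \<omega> in M. ?c k \<omega> * erw_op p k f (S k \<omega>) \<le> cosh l * (?c k \<omega> * f (S k \<omega>))"
        using drift by (simp add: of_bool_def)
    qed (auto intro!: adapted_mult[OF adapted_const] adapted_confined_mult)
    also have "\<dots> = cosh l * u k" by (simp add: u_def)
    finally have "u (Suc k) + y * (1 - confined_prob m (Suc k)) \<le> cosh l * u k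
        + y * (1 - confined_prob m k)"
      using WSuc[of k] by simp
    also have "\<dots> \<le> cosh l * (u k + y * (1 - confined_prob m k))"
      using c1 confined_prob_bounds[of m k] mult_right_mono[OF c1, of "y * (1 - confined_prob m k)"]
      by (simp add: y_def algebra_simps)
    also have "\<dots> \<le> cosh l * cosh l ^ k" using Suc.IH by simp
    finally show ?case by simp
  qed
  have "\<P>(\<omega> in M. \<exists>k\<le>n. x \<le> \<bar>real_of_int (S k \<omega>)\<bar>) \<le> \<P>(\<omega> in M. \<not> confined m n \<omega>)"
  proof (rule finite_measure_mono)
    show "{\<omega> \<in> space M. \<exists>k\<le>n. x \<le> \<bar>real_of_int (S k \<omega>)\<bar>} \<subseteq> {\<omega> \<in> space M. \<not> confined m n \<omega>}"
    proof safe
      fix \<omega> k assume *: "k \<le> n" "x \<le> \<bar>real_of_int (S k \<omega>)\<bar>" "confined m n \<omega>"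
      from *(2) have "\<lceil>x\<rceil> \<le> \<bar>S k \<omega>\<bar>" by linarith
      moreover have "\<bar>S k \<omega>\<bar> < int m" using * by (auto simp: confined_def)
      ultimately show False using x by (simp add: m_def)
    qed
  qed measurable
  also have "\<dots> = 1 - confined_prob m n"
    unfolding confined_prob_eq by (rule prob_neg) simp
  also have "\<dots> \<le> cosh l ^ n / y"
    using W[OF n] u0[of n] by (simp add: y_def field_simps)
  also have "\<dots> \<le> exp (l\<^sup>2 / 2) ^ n / (exp (l * x) / 2)"
  proof (intro frac_le power_mono cosh_le_exp_half_square l)
    have "exp (l * x) / 2 \<le> exp (l * real m) / 2" using l m by simp
    also have "\<dots> \<le> y" by (simp add: y_def cosh_field_def)
    finally show "exp (l * x) / 2 \<le> y" .
  qed auto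
  also have "\<dots> = 2 * exp (n * (l\<^sup>2 / 2) - l * x)"
    by (simp add: exp_diff exp_of_nat_mult[symmetric] del: times_divide_eq_right) simp
  also have "n * (l\<^sup>2 / 2) - l * x = - x\<^sup>2 / (2 * n)"
    using n by (simp add: l_def field_simps power2_eq_square)
  finally show ?thesis .
qed

text \<open>
Blocks \<open>\<theta>\<^sup>k \<le> n < \<theta>\<^sup>k\<^sup>+\<^sup>1\<close> with \<open>\<theta> = 1 + \<epsilon>\<close>: for the maximum over a block to exceed the level at the
block's start, the maximal inequality gives the exponent \<open>\<theta>\<^sup>2 / \<theta> = \<theta> > 1\<close>, so these
probabilities are \<open>O(k\<^sup>-\<^sup>\<theta>)\<close> and summable.
\<close>

lemma lil_upper_eventually:
  assumes p: "p \<le> 1/2" and e: "\<epsilon> > 0"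
  shows "AE \<omega> in M. eventually (\<lambda>n. \<bar>real_of_int (S n \<omega>)\<bar> \<le> (1 + \<epsilon>) * lil_scale n) sequentially"
proof -
  define \<theta> where "\<theta> = 1 + \<epsilon>"
  have \<theta>: "\<theta> > 1" using e by (simp add: \<theta>_def)
  define N where "N k = nat \<lfloor>\<theta> ^ Suc k\<rfloor>" for k
  have N: "real (N k) \<le> \<theta> ^ Suc k" "N k \<ge> 1" for k
  proof -
    have "1 \<le> \<theta> ^ Suc k" using \<theta> by (intro one_le_power) auto
    then show "real (N k) \<le> \<theta> ^ Suc k" "N k \<ge> 1" unfolding N_def by linarith+
  qed
  define A where "A k = {\<omega> \<in> space M. \<exists>j\<le>N k. \<theta> * lil_scale (\<theta> ^ k) \<le> \<bar>real_of_int (S j \<omega>)\<bar>}" for k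
  have A_sets: "A k \<in> sets M" for k unfolding A_def by measurable
  have large: "eventually (\<lambda>k. exp 1 < \<theta> ^ k) sequentially"
    using \<theta> by (intro filterlim_at_top_dense[THEN iffD1, rule_format]) real_asymp
  have bound: "eventually (\<lambda>k. norm (measure M (A k))
      \<le> (2 * ln \<theta> powr (- \<theta>)) * real k powr (- \<theta>)) sequentially"
    using large eventually_ge_at_top[of 1]
  proof eventually_elim
    case (elim k)
    define L where "L = ln (ln (\<theta> ^ k))"
    have tk: "\<theta> ^ k > 0" using \<theta> by simp
    have "1 < ln (\<theta> ^ k)" using elim(1) tk by (metis exp_less_cancel_iff exp_ln)
    then have L: "L > 0" by (simp add: L_def)
    have pos: "0 < \<theta> * lil_scale (\<theta> ^ k)"
      using \<theta> tk L by (simp add: lil_scale_def L_def[symmetric])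
    have "measure M (A k) \<le> 2 * exp (- (\<theta> * lil_scale (\<theta> ^ k))\<^sup>2 / (2 * N k))"
      unfolding A_def by (rule maximal_inequality[OF p N(2) pos])
    also have "(\<theta> * lil_scale (\<theta> ^ k))\<^sup>2 = \<theta>\<^sup>2 * (2 * \<theta> ^ k * L)"
      using tk L by (simp add: lil_scale_def L_def[symmetric] power_mult_distrib)
    also have "2 * exp (- (\<theta>\<^sup>2 * (2 * \<theta> ^ k * L)) / (2 * N k))
        \<le> 2 * exp (- (\<theta>\<^sup>2 * (2 * \<theta> ^ k * L)) / (2 * \<theta> ^ Suc k))"
    proof -
      have "(\<theta>\<^sup>2 * (2 * \<theta> ^ k * L)) / (2 * \<theta> ^ Suc k) \<le> (\<theta>\<^sup>2 * (2 * \<theta> ^ k * L)) / (2 * N k)"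
        using N[of k] \<theta> tk L by (intro divide_left_mono) auto
      then show ?thesis by simp
    qed
    also have "(\<theta>\<^sup>2 * (2 * \<theta> ^ k * L)) / (2 * \<theta> ^ Suc k) = \<theta> * L"
      using \<theta> tk by (simp add: power2_eq_square)
    then have "- (\<theta>\<^sup>2 * (2 * \<theta> ^ k * L)) / (2 * \<theta> ^ Suc k) = - (\<theta> * L)" by (metis minus_divide_left)
    also have "exp (- (\<theta> * L)) = (real k * ln \<theta>) powr (- \<theta>)"
    proof -
      have "ln (\<theta> ^ k) = real k * ln \<theta>" using \<theta> by (simp add: ln_realpow)
      then show ?thesis using \<open>1 < ln (\<theta> ^ k)\<close> elim(2) \<theta> by (simp add: powr_def L_def)
    qed
    also have "\<dots> = ln \<theta> powr (- \<theta>) * real k powr (- \<theta>)"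
      using \<theta> by (simp add: powr_mult mult.commute)
    finally show ?case by simp
  qed
  have "summable (\<lambda>k. (2 * ln \<theta> powr (- \<theta>)) * real k powr (- \<theta>))"
    using \<theta> by (intro summable_mult) (simp add: summable_real_powr_iff)
  then have "summable (\<lambda>k. measure M (A k))"
    by (rule summable_comparison_test_ev[OF bound])
  then have "AE \<omega> in M. eventually (\<lambda>k. \<omega> \<in> space M - A k) sequentially"
    by (intro borel_cantelli_AE1 A_sets) (auto simp: emeasure_eq_measure)
  then show ?thesis
  proof eventually_elim
    case (elim \<omega>)
    with large have "eventually (\<lambda>k. \<omega> \<in> space M - A k \<and> exp 1 < \<theta> ^ k) sequentially"
      by eventually_elim auto
    then obtain K where K: "\<And>k. k \<ge> K \<Longrightarrow> \<omega> \<in> space M - A k \<and> exp 1 < \<theta> ^ k"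
      unfolding eventually_sequentially by blast
    have "\<bar>real_of_int (S n \<omega>)\<bar> \<le> (1 + \<epsilon>) * lil_scale n" if n: "real n \<ge> \<theta> ^ K" "n \<ge> 1" for n
    proof -
      define k where "k = nat \<lfloor>log \<theta> n\<rfloor>"
      have "0 \<le> log \<theta> n" using n \<theta> by simp
      then have k: "real k \<le> log \<theta> n" "log \<theta> n < real (Suc k)" unfolding k_def by linarith+
      have "\<theta> powr real k \<le> real n" "real n < \<theta> powr real (Suc k)"
        using k n \<theta> by (simp_all add: le_log_iff log_less_iff)
      then have tk: "\<theta> ^ k \<le> real n" "real n < \<theta> ^ Suc k"
        using \<theta> by (simp_all only: powr_realpow)
      have "K \<le> k"
      proof (rule ccontr)
        assume "\<not> K \<le> k"
        then have "\<theta> ^ Suc k \<le> \<theta> ^ K" using \<theta> by (intro power_increasing) auto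
        then show False using n(1) tk by linarith
      qed
      from K[OF this] have w: "\<omega> \<in> space M" "\<omega> \<notin> A k" "exp 1 < \<theta> ^ k" by auto
      have "n \<le> N k" unfolding N_def using tk(2) by linarith
      then have "\<bar>real_of_int (S n \<omega>)\<bar> < \<theta> * lil_scale (\<theta> ^ k)"
        using w unfolding A_def by (metis (mono_tags, lifting) mem_Collect_eq not_le)
      also have "\<dots> \<le> \<theta> * lil_scale n"
        using \<theta> w tk by (intro mult_left_mono lil_scale_mono) auto
      finally show ?thesis by (simp add: \<theta>_def)
    qed
    then show ?case
      by (intro eventually_sequentiallyI[of "max 1 (nat \<lceil>\<theta> ^ K\<rceil>)"]) auto
  qed
qed

lemma lil_upper:
  assumes p: "p \<le> 1/2"
  shows "AE \<omega> in M. limsup (\<lambda>n. ereal (real_of_int \<bar>S n \<omega>\<bar> / sqrt (2 * real n * ln (ln (real n))))) \<le> 1"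
proof -
  have "AE \<omega> in M. \<forall>i. eventually (\<lambda>n. \<bar>real_of_int (S n \<omega>)\<bar>
      \<le> (1 + inverse (real (Suc i))) * lil_scale n) sequentially"
    unfolding AE_all_countable by (intro allI lil_upper_eventually[OF p]) simp
  then show ?thesis
  proof eventually_elim
    case (elim \<omega>)
    let ?X = "\<lambda>n. ereal (real_of_int \<bar>S n \<omega>\<bar> / sqrt (2 * real n * ln (ln (real n))))"
    have "limsup ?X \<le> ereal (1 + inverse (real (Suc i)))" for i
    proof (rule Limsup_bounded)
      have "eventually (\<lambda>n::nat. ln (ln (real n)) > 0) sequentially" by real_asymp
      moreover have "eventually (\<lambda>n::nat. real n > 0) sequentially" by real_asymp
      moreover have "eventually (\<lambda>n. \<bar>real_of_int (S n \<omega>)\<bar>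
          \<le> (1 + inverse (real (Suc i))) * lil_scale n) sequentially"
        using elim by blast
      ultimately show "eventually (\<lambda>n. ?X n \<le> ereal (1 + inverse (real (Suc i)))) sequentially"
      proof eventually_elim
        case (elim n)
        then have "lil_scale n > 0" by (simp add: lil_scale_def)
        then show ?case using elim(3) by (simp add: lil_scale_def[symmetric] divide_le_eq)
      qed
    qed
    moreover have "(\<lambda>i. ereal (1 + inverse (real (Suc i)))) \<longlonglongrightarrow> ereal (1 + 0)"
      by (intro tendsto_intros LIMSEQ_inverse_real_of_nat)
    ultimately have "limsup ?X \<le> ereal (1 + 0)"
      by (intro LIMSEQ_le_const) blast+
    then show "limsup ?X \<le> 1" by (simp add: one_ereal_def)
  qed
qed

end

section \<open>Lower bound in the law of the iterated logarithm\<close>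

text \<open>
The ratio of the binomial coefficients at \<open>m + l + 1\<close> and \<open>m + l\<close> is at least \<open>1 - y\<close> with
\<open>y = (2 l + 1) / m\<close>, and \<open>ln (1 - y) \<ge> - y - 2 y\<^sup>2\<close>.  The linear terms add up to \<open>l\<^sup>2 / m\<close> and the
quadratic ones to at most \<open>8 l\<^sup>3 / m\<^sup>2\<close>.
\<close>

lemma binomial_gaussian_lower_bound:
  assumes "4 * l \<le> m"
  shows "real (2 * m choose m) * exp (- (real l ^ 2 / m) - 8 * real l ^ 3 / real m ^ 2)
      \<le> real (2 * m choose (m + l))"
  using assms
proof (induction l)
  case (Suc l)
  have m: "m > 0" "real m > 0" using Suc.prems by auto
  define y where "y = (2 * real l + 1) / m"
  have y: "0 \<le> y" "y \<le> 1/2" using Suc.prems m by (auto simp: y_def field_simps)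
  have "(m + l + 1) * (2 * m choose (m + l + 1)) = (m - l) * (2 * m choose (m + l))"
    using binomial_absorb_comp[of "2 * m" "m + l"] binomial_absorption[of "m + l" "2 * m"] by simp
  then have "real (m + l + 1) * real (2 * m choose (m + l + 1))
      = real (m - l) * real (2 * m choose (m + l))"
    by (metis of_nat_mult)
  then have eq: "real (2 * m choose (m + Suc l))
      = (real m - real l) / (m + l + 1) * real (2 * m choose (m + l))"
    using Suc.prems by (simp add: field_simps of_nat_diff)
  have "exp (- y - 2 * y ^ 2) \<le> exp (ln (1 - y))"
    using ln_one_minus_pos_lower_bound[of y] y by (simp only: exp_le_cancel_iff)
  also have "\<dots> = 1 - y" using y by simp
  also have "1 - y \<le> (real m - real l) / (m + l + 1)"
  proof -
    have "(real m - real l) / (m + l + 1) = 1 - (2 * real l + 1) / (m + l + 1)"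
      by (simp add: field_simps)
    moreover have "(2 * real l + 1) / (m + l + 1) \<le> y"
      unfolding y_def using m by (intro divide_left_mono) auto
    ultimately show ?thesis by simp
  qed
  finally have ratio: "exp (- y - 2 * y ^ 2) \<le> (real m - real l) / (m + l + 1)" .
  have "- (real (Suc l) ^ 2 / m) - 8 * real (Suc l) ^ 3 / real m ^ 2
      \<le> (- (real l ^ 2 / m) - 8 * real l ^ 3 / real m ^ 2) + (- y - 2 * y ^ 2)"
  proof -
    have "real (Suc l) ^ 2 / m = real l ^ 2 / m + y"
      by (simp add: y_def power2_eq_square add_divide_distrib[symmetric] algebra_simps)
    moreover have "8 * real l ^ 3 / real m ^ 2 + 2 * y ^ 2 \<le> 8 * real (Suc l) ^ 3 / real m ^ 2"
    proof -
      have "8 * real l ^ 3 + 2 * (2 * real l + 1) ^ 2 \<le> 8 * real (Suc l) ^ 3"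
        by (simp add: power2_eq_square power3_eq_cube algebra_simps)
      then have "(8 * real l ^ 3 + 2 * (2 * real l + 1) ^ 2) / real m ^ 2
          \<le> 8 * real (Suc l) ^ 3 / real m ^ 2"
        by (intro divide_right_mono) auto
      moreover have "2 * y ^ 2 = 2 * (2 * real l + 1) ^ 2 / real m ^ 2"
        by (simp only: y_def power_divide times_divide_eq_right)
      ultimately show ?thesis by (simp only: add_divide_distrib)
    qed
    ultimately show ?thesis by simp
  qed
  then have "exp (- (real (Suc l) ^ 2 / m) - 8 * real (Suc l) ^ 3 / real m ^ 2)
     \<le> exp (- (real l ^ 2 / m) - 8 * real l ^ 3 / real m ^ 2) * exp (- y - 2 * y ^ 2)"
    by (simp only: exp_add[symmetric] exp_le_cancel_iff)
  then have "real (2 * m choose m) * exp (- (real (Suc l) ^ 2 / m) - 8 * real (Suc l) ^ 3 / real m ^ 2)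
     \<le> real (2 * m choose m) *
         (exp (- (real l ^ 2 / m) - 8 * real l ^ 3 / real m ^ 2) * exp (- y - 2 * y ^ 2))"
    by (intro mult_left_mono) auto
  also have "\<dots> = (real (2 * m choose m) * exp (- (real l ^ 2 / m) - 8 * real l ^ 3 / real m ^ 2)) * exp
      (- y - 2 * y ^ 2)"
    by simp
  also have "\<dots> \<le> real (2 * m choose (m + l)) * ((real m - real l) / (m + l + 1))"
    using Suc by (intro mult_mono ratio Suc.IH) auto
  finally show ?case unfolding eq by (simp add: mult.commute)
qed simp

lemma central_binomial_eventually_ge: "eventually (\<lambda>m. 1/2
    \<le> sqrt (real m) * (real (2 * m choose m) / 4 ^ m)) sequentially"
proof -
  have "(\<lambda>m. (1 / sqrt pi) * (sqrt (pi * m) * (real (2 * m choose m) / 4 ^ m))) \<longlonglongrightarrow> (1 / sqrt pi) * 1"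
    by (intro tendsto_intros central_binomial_asymptotics)
  then have "(\<lambda>m. sqrt (real m) * (real (2 * m choose m) / 4 ^ m)) \<longlonglongrightarrow> 1 / sqrt pi"
    by (simp add: real_sqrt_mult)
  moreover have "1/2 < 1 / sqrt pi"
  proof -
    have "sqrt pi < sqrt 4" using pi_less_4 by (simp only: real_sqrt_less_iff)
    then show ?thesis by (simp add: field_simps)
  qed
  ultimately have "eventually (\<lambda>m. 1/2 < sqrt (real m) * (real (2 * m choose m) / 4 ^ m)) sequentially"
    by (rule order_tendstoD)
  then show ?thesis by eventually_elim simp
qed

definition far_indicator :: "real \<Rightarrow> int \<Rightarrow> real" where
  "far_indicator t s = of_bool (t \<le> \<bar>real_of_int s\<bar>)"

lemma far_indicator_radially_monotone: "c \<ge> 0 \<Longrightarrow> radially_monotone c (far_indicator t)"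
  unfolding radially_monotone_def far_indicator_def by (auto simp: of_bool_def)

text \<open>
The central binomial probability loses a factor \<open>\<surd>m\<close>, which is recovered by adding the
\<open>\<lfloor>\<surd>m\<rfloor> + 1\<close> probabilities just beyond the level \<open>t\<close>.
\<close>

lemma srw_tail_lower_bound:
  fixes t :: real
  assumes central: "1/2 \<le> sqrt (real m) * (real (2 * m choose m) / 4 ^ m)"
    and t: "t \<ge> 0" and m: "m \<ge> 1"
    and u: "t / 2 + 1 + sqrt m \<le> u" "4 * u \<le> m"
  shows "1/2 * exp (- (u ^ 2 / m) - 8 * u ^ 3 / real m ^ 2) \<le> (srw_op ^^ (2 * m)) (far_indicator t) 0"
proof -
  define q where "q = nat \<lfloor>sqrt m\<rfloor>"
  define l0 where "l0 = nat \<lceil>t / 2\<rceil>"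
  have q: "real q \<le> sqrt m" "sqrt m \<le> real q + 1"
    by (auto simp: q_def)
  have l0: "t / 2 \<le> real l0" "real l0 \<le> t / 2 + 1"
    using t by (auto simp: l0_def)
  have lq: "real (l0 + q) \<le> u" using q l0 u by simp
  then have "real (4 * (l0 + q)) \<le> real m" using u by simp
  then have lm: "4 * (l0 + q) \<le> m" by (simp only: of_nat_le_iff)
  define E where "E = exp (- (u ^ 2 / m) - 8 * u ^ 3 / real m ^ 2)"
  let ?C = "real (2 * m choose m) / 4 ^ m"
  have each: "?C * E \<le> real (2 * m choose (m + l)) / 4 ^ m" if "l \<in> {l0..l0+q}" for l
  proof -
    have lu: "real l \<le> u" using that lq by simp
    have "u ^ 2 / m \<ge> real l ^ 2 / m" "8 * u ^ 3 / real m ^ 2 \<ge> 8 * real l ^ 3 / real m ^ 2"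
      using lu by (auto intro!: divide_right_mono power_mono)
    then have "E \<le> exp (- (real l ^ 2 / m) - 8 * real l ^ 3 / real m ^ 2)"
      unfolding E_def by simp
    then have "real (2 * m choose m) * E
        \<le> real (2 * m choose m) * exp (- (real l ^ 2 / m) - 8 * real l ^ 3 / real m ^ 2)"
      by (intro mult_left_mono) auto
    also have "\<dots> \<le> real (2 * m choose (m + l))"
      by (rule binomial_gaussian_lower_bound) (use that lm in auto)
    finally show ?thesis by (simp add: divide_right_mono)
  qed
  have "1/2 * E \<le> sqrt m * ?C * E"
    using central by (intro mult_right_mono) (auto simp: E_def)
  also have "\<dots> \<le> (real q + 1) * ?C * E"
    using q by (intro mult_right_mono) (auto simp: E_def)
  also have "\<dots> = (\<Sum>l\<in>{l0..l0+q}. ?C * E)"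
    by (simp add: algebra_simps)
  also have "\<dots> \<le> (\<Sum>l\<in>{l0..l0+q}. real (2 * m choose (m + l)) / 4 ^ m)"
    by (rule sum_mono) (rule each)
  also have "\<dots> = (\<Sum>l\<in>{l0..l0+q}. real (2 * m choose (m + l)) / 2 ^ (2 * m) * far_indicator t (0
      + 2 * int (m + l) - int (2 * m)))"
  proof (rule sum.cong[OF refl])
    fix l assume "l \<in> {l0..l0+q}"
    then have "t \<le> 2 * real l" using l0 by auto
    then have "far_indicator t (0 + 2 * int (m + l) - int (2 * m)) = 1" by (simp add: far_indicator_def)
    then show "real (2 * m choose (m + l)) / 4 ^ m
        = real (2 * m choose (m + l)) / 2 ^ (2 * m) * far_indicator t (0 + 2 * int (m + l) - int (2 * m))"
      by (simp add: power_mult)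
  qed
  also have "\<dots> = (\<Sum>i\<in>(\<lambda>l. m + l) ` {l0..l0+q}. real (2 * m choose i) / 2 ^ (2 * m) * far_indicator t (0
      + 2 * int i - int (2 * m)))"
    by (subst sum.reindex) auto
  also have "\<dots> \<le> (\<Sum>i\<le>2*m. real (2 * m choose i) / 2 ^ (2 * m) * far_indicator t (0
      + 2 * int i - int (2 * m)))"
    by (rule sum_mono2) (use lm in \<open>auto simp: far_indicator_def\<close>)
  finally show ?thesis unfolding E_def srw_op_iter_eq_binomial_sum .
qed

text \<open>
This is \<open>srw_tail_lower_bound\<close> for a block of \<open>2 e t\<close> steps that ends at time \<open>t\<close>: \<open>u t\<close> is half
the level plus the width of the window there.  The leading term of
\<open>u\<^sup>2 / (e t)\<close> is \<open>c\<^sup>2 / (2 e)\<close> times \<open>ln (ln t)\<close>, and the cubic term is negligible.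
\<close>

lemma lil_lower_asymptotics:
  fixes c e :: real
  assumes "0 < c" "0 < e" "c\<^sup>2 < 2 * e"
  defines "u \<equiv> \<lambda>t. c * lil_scale t / 2 + 1 + sqrt (e * t)"
  shows "eventually (\<lambda>t. 4 * u t \<le> e * t \<and> (u t) ^ 2 / (e * t) + 8 * (u t) ^ 3 / (e * t) ^ 2
      \<le> ln (ln t)) at_top"
proof -
  have "((\<lambda>t. u t / t) \<longlongrightarrow> 0) at_top"
    unfolding u_def lil_scale_def using assms by real_asymp
  then have small: "eventually (\<lambda>t. u t / t < e / 4) at_top"
    by (rule order_tendstoD) (use assms in auto)
  have "((\<lambda>t. ((u t) ^ 2 / (e * t) + 8 * (u t) ^ 3 / (e * t) ^ 2) / ln (ln t)) \<longlongrightarrow>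
      (c * 2 powr (1 / 2) / 2)\<^sup>2 * inverse e) at_top"
    unfolding u_def lil_scale_def using assms by real_asymp
  moreover have "(c * 2 powr (1 / 2) / 2)\<^sup>2 * inverse e = c\<^sup>2 / (2 * e)"
    using assms(2) by (simp add: powr_half_sqrt power_mult_distrib power_divide field_simps)
  ultimately have "((\<lambda>t. ((u t) ^ 2 / (e * t)
      + 8 * (u t) ^ 3 / (e * t) ^ 2) / ln (ln t)) \<longlongrightarrow> c\<^sup>2 / (2 * e)) at_top"
    by simp
  then have "eventually (\<lambda>t. ((u t) ^ 2 / (e * t) + 8 * (u t) ^ 3 / (e * t) ^ 2) / ln (ln t) < 1) at_top"
    by (rule order_tendstoD) (use assms in auto)
  moreover have "eventually (\<lambda>t::real. ln (ln t) > 0) at_top" by real_asymp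
  moreover have "eventually (\<lambda>t::real. t > 0) at_top" by real_asymp
  moreover note small
  ultimately show ?thesis
    by eventually_elim (auto simp: field_simps)
qed

context elephant_random_walk
begin

text \<open>
At even times the walk is at an even position, where a radially increasing function is at least its
value at \<open>0\<close>; hence the past can only help the walk to be far away.
\<close>

lemma far_conditional_lower_bound:
  assumes p: "p \<ge> 1/2" and n: "n \<ge> 1" "even n" and g: "adapted n g" "\<And>\<omega>. 0 \<le> g \<omega>"
  shows "(srw_op ^^ (2 * m)) (far_indicator t) 0 * (\<integral>\<omega>. g \<omega> \<partial>M)
      \<le> (\<integral>\<omega>. g \<omega> * far_indicator t (S (n + 2 * m) \<omega>) \<partial>M)"
proof -
  let ?h = "(srw_op ^^ (2 * m)) (far_indicator t)"
  have rm1: "radially_monotone 1 ?h"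
    by (intro srw_op_iter_radially_monotone far_indicator_radially_monotone) simp
  have even: "AE \<omega> in M. even (S n \<omega>)"
    using S_path
  proof eventually_elim
    case (elim \<omega>)
    have "even (S k \<omega>) \<longleftrightarrow> even k" for k
    proof (induction k)
      case (Suc k)
      have "S (Suc k) \<omega> = S k \<omega> + 1 \<or> S (Suc k) \<omega> = S k \<omega> - 1" using elim by blast
      then show ?case using Suc.IH by auto
    qed (use elim in simp)
    then show ?case using n by simp
  qed
  have "?h 0 * (\<integral>\<omega>. g \<omega> \<partial>M) = (\<integral>\<omega>. g \<omega> * ?h 0 \<partial>M)" by simp
  also have "\<dots> \<le> (\<integral>\<omega>. g \<omega> * ?h (S n \<omega>) \<partial>M)"
  proof (rule expectation_mono_AE[of n])
    show "AE \<omega> in M. g \<omega> * ?h 0 \<le> g \<omega> * ?h (S n \<omega>)"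
      using even by eventually_elim (intro mult_left_mono radially_monotone_even_ge_0 rm1 g)
  qed (intro adapted_mult g adapted_fun_S adapted_const; simp)+
  also have "\<dots> \<le> (\<integral>\<omega>. g \<omega> * far_indicator t (S (n + 2 * m) \<omega>) \<partial>M)"
    by (rule srw_domination[OF n(1) g(1)])
       (use p g in \<open>auto intro!: far_indicator_radially_monotone\<close>)
  finally show ?thesis .
qed

text \<open>
Missing the levels at all ends of blocks \<open>K, \<dots>, L - 1\<close> has probability at most
\<open>\<Prod>(1 - r\<^sub>k) \<le> exp (- \<Sum>r\<^sub>k)\<close>, as the bound on each block holds conditionally on the earlier ones.
\<close>

lemma infinitely_often_far:
  fixes N m :: "nat \<Rightarrow> nat" and t :: "nat \<Rightarrow> real"
  assumes p: "p \<ge> 1/2"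
    and N: "\<And>k. N k \<ge> 1" "\<And>k. even (N k)" "\<And>k. N (Suc k) = N k + 2 * m k"
    and div: "\<not> summable (\<lambda>k. (srw_op ^^ (2 * m k)) (far_indicator (t (Suc k))) 0)"
  shows "AE \<omega> in M. \<exists>\<^sub>\<infinity>k. t k \<le> \<bar>real_of_int (S (N k) \<omega>)\<bar>"
proof -
  define r where "r k = (srw_op ^^ (2 * m k)) (far_indicator (t (Suc k))) 0" for k
  have r0: "0 \<le> r k" for k
    unfolding r_def srw_op_iter_eq_binomial_sum far_indicator_def by (intro sum_nonneg) auto
  have Nmono: "N k \<le> N l" if "k \<le> l" for k l
    using that by (induction l rule: dec_induct) (auto simp: N(3))
  define Q where "Q K L \<omega> \<longleftrightarrow> (\<forall>k\<in>{K<..L}. \<not> t k \<le> \<bar>real_of_int (S (N k) \<omega>)\<bar>)" for K L \<omega>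
  have adQ: "adapted (N L) (\<lambda>\<omega>. of_bool (Q K L \<omega>) :: real)" for K L
  proof -
    have "adapted (N L) (\<lambda>\<omega>. \<not> t k \<le> \<bar>real_of_int (S (N k) \<omega>)\<bar>)" if "k \<in> {K<..L}" for k
      by (rule adapted_fun_S[of _ _ "\<lambda>s. \<not> t k \<le> \<bar>real_of_int s\<bar>"]) (use Nmono that in auto)
    then show ?thesis unfolding Q_def by (intro adapted_of_bool adapted_all)
  qed
  have Qbound: "(\<integral>\<omega>. of_bool (Q K (K + d) \<omega>) \<partial>M) \<le> exp (- (\<Sum>k<d. r (K + k)))" for K d
  proof (induction d)
    case 0
    have "Q K K \<omega>" for \<omega> by (simp add: Q_def)
    then show ?case by (simp add: prob_space)
  next
    case (Suc d)
    let ?L = "K + d"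
    let ?g = "\<lambda>\<omega>. of_bool (Q K ?L \<omega>) :: real"
    let ?F = "\<lambda>\<omega>. far_indicator (t (Suc ?L)) (S (N (Suc ?L)) \<omega>)"
    have ad: "adapted (N (Suc ?L)) ?g" by (rule adapted_mono[OF adQ Nmono]) simp
    have ad2: "adapted (N (Suc ?L)) (\<lambda>\<omega>. ?g \<omega> * ?F \<omega>)"
      by (intro adapted_mult ad adapted_fun_S) simp
    have "r ?L * (\<integral>\<omega>. ?g \<omega> \<partial>M) \<le> (\<integral>\<omega>. ?g \<omega> * ?F \<omega> \<partial>M)"
      unfolding r_def N(3) by (rule far_conditional_lower_bound[OF p N(1,2) adQ]) simp
    moreover have "of_bool (Q K (Suc ?L) \<omega>) = ?g \<omega> - ?g \<omega> * ?F \<omega>" for \<omega>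
    proof -
      have "{K<..Suc ?L} = insert (Suc ?L) {K<..?L}" by auto
      then show ?thesis by (auto simp: Q_def far_indicator_def of_bool_def)
    qed
    then have "(\<integral>\<omega>. of_bool (Q K (Suc ?L) \<omega>) \<partial>M) = (\<integral>\<omega>. ?g \<omega> \<partial>M) - (\<integral>\<omega>. ?g \<omega> * ?F \<omega> \<partial>M)"
      using Bochner_Integration.integral_diff[OF adapted_integrable[OF ad] adapted_integrable[OF ad2]] by
          simp
    ultimately have "(\<integral>\<omega>. of_bool (Q K (Suc ?L) \<omega>) \<partial>M) \<le> (1 - r ?L) * (\<integral>\<omega>. ?g \<omega> \<partial>M)"
      by (simp add: algebra_simps)
    also have "\<dots> \<le> exp (- r ?L) * (\<integral>\<omega>. ?g \<omega> \<partial>M)"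
      using exp_ge_add_one_self[of "- r ?L"]
          by (intro mult_right_mono Bochner_Integration.integral_nonneg) auto
    also have "\<dots> \<le> exp (- r ?L) * exp (- (\<Sum>k<d. r (K + k)))"
      by (intro mult_left_mono Suc.IH) simp
    also have "\<dots> = exp (- (\<Sum>k<Suc d. r (K + k)))"
      by (simp add: exp_add[symmetric])
    finally show ?case by simp
  qed
  \<comment> \<open>A positive probability of missing all levels from some block on would make \<open>r\<close> summable.\<close>
  have never: "AE \<omega> in M. \<not> (\<forall>k>K. \<not> t k \<le> \<bar>real_of_int (S (N k) \<omega>)\<bar>)" for K
  proof -
    let ?P = "\<lambda>\<omega>. \<forall>k>K. \<not> t k \<le> \<bar>real_of_int (S (N k) \<omega>)\<bar>"
    have P[measurable]: "Measurable.pred M ?P" by measurable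
    have int: "integrable M (\<lambda>\<omega>. of_bool (?P \<omega>) :: real)"
      using integrable_mult_of_bool[OF _ P, of "\<lambda>_. 1"] by simp
    have le: "(\<integral>\<omega>. of_bool (?P \<omega>) \<partial>M) \<le> exp (- (\<Sum>k<d. r (K + k)))" for d
    proof -
      have "(\<integral>\<omega>. of_bool (?P \<omega>) \<partial>M) \<le> (\<integral>\<omega>. of_bool (Q K (K + d) \<omega>) \<partial>M :: real)"
        by (rule integral_mono[OF int adapted_integrable[OF adQ]]) (auto simp: Q_def)
      also note Qbound
      finally show ?thesis .
    qed
    have "\<not> summable (\<lambda>k. r (K + k))"
    proof -
      have "\<not> summable r" using div by (simp add: r_def[abs_def])
      then show ?thesis using summable_iff_shift[of r K] by (simp add: add.commute)
    qed
    have "(\<integral>\<omega>. of_bool (?P \<omega>) \<partial>M) \<le> (0::real)"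
    proof (rule ccontr)
      assume "\<not> ?thesis"
      then have pos: "0 < (\<integral>\<omega>. of_bool (?P \<omega>) \<partial>M :: real)" (is "0 < ?e") by simp
      have "(\<Sum>k<d. r (K + k)) \<le> - ln ?e" for d
      proof -
        have "ln ?e \<le> ln (exp (- (\<Sum>k<d. r (K + k))))" using le[of d] pos by (subst ln_le_cancel_iff) auto
        then show ?thesis by simp
      qed
      then have "summable (\<lambda>k. r (K + k))"
        by (intro summableI_nonneg_bounded r0)
      then show False using \<open>\<not> summable (\<lambda>k. r (K + k))\<close> by simp
    qed
    moreover have "0 \<le> (\<integral>\<omega>. of_bool (?P \<omega>) \<partial>M :: real)" by (rule Bochner_Integration.integral_nonneg) auto
    ultimately have "AE \<omega> in M. of_bool (?P \<omega>) = (0::real)"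
      using int by (subst integral_nonneg_eq_0_iff_AE[symmetric]) auto
    then show ?thesis by eventually_elim (auto simp only: of_bool_eq_0_iff)
  qed
  have "AE \<omega> in M. \<forall>K. \<not> (\<forall>k>K. \<not> t k \<le> \<bar>real_of_int (S (N k) \<omega>)\<bar>)"
    unfolding AE_all_countable using never by blast
  then show ?thesis by eventually_elim (auto simp: INFM_nat)
qed

text \<open>
Take times \<open>2 b\<^sup>k\<close>.  The simple walk restarted at \<open>0\<close> sees only the fraction \<open>1 - 1/b\<close> of the time,
which is harmless when \<open>b\<close> is so large that \<open>c\<^sup>2 < 1 - 1/b\<close>: the tail at the level \<open>c\<close> times
the scale then is at least \<open>1 / (2 ln (2 b\<^sup>k\<^sup>+\<^sup>1))\<close>, a harmonic series.
\<close>

lemma lil_lower_infinitely_often: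
  assumes p: "p \<ge> 1/2" and c: "0 < c" "c < 1"
  shows "AE \<omega> in M. \<exists>\<^sub>\<infinity>n. c * lil_scale n \<le> \<bar>real_of_int (S n \<omega>)\<bar>"
proof -
  have c2: "c\<^sup>2 < 1" using c by (simp add: power_less_one_iff)
  obtain b0 :: nat where b0: "1 / (1 - c\<^sup>2) < real b0" using reals_Archimedean2 by blast
  \<comment> \<open>Then \<open>c\<^sup>2 < 1 - 1/b\<close>, which is \<open>2 e\<close> below.\<close>
  define b where "b = b0 + 2"
  have b: "b \<ge> 2" "1 / (1 - c\<^sup>2) < real b" using b0 by (auto simp: b_def)
  define e where "e = (real b - 1) / (2 * real b)"
  have e: "e > 0" using b by (simp add: e_def)
  have ce: "c\<^sup>2 < 2 * e"
  proof -
    have "1 < real b * (1 - c\<^sup>2)" using b(2) c2 by (simp add: field_simps)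
    then have "c\<^sup>2 * real b < real b - 1" by (simp add: algebra_simps)
    then show ?thesis using b by (simp add: e_def field_simps)
  qed
  define N where "N k = 2 * b ^ k" for k
  define m where "m k = (b - 1) * b ^ k" for k
  have NSuc: "N (Suc k) = N k + 2 * m k" for k
    using b by (simp add: N_def m_def algebra_simps)
  have me: "real (m k) = e * real (N (Suc k))" for k
    using b by (simp add: N_def m_def e_def of_nat_diff)
  define t where "t k = c * lil_scale (N k)" for k
  define r where "r k = (srw_op ^^ (2 * m k)) (far_indicator (t (Suc k))) 0" for k
  have m_lim: "filterlim m at_top sequentially"
    unfolding m_def using b by (intro filterlim_subseq strict_monoI) (auto intro: power_strict_increasing)
  have N_sm: "strict_mono N"
    unfolding N_def using b by (intro strict_monoI) (auto intro: power_strict_increasing)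
  have NSuc_lim: "filterlim (\<lambda>k. real (N (Suc k))) at_top sequentially"
    by (intro filterlim_compose[OF filterlim_real_sequentially] filterlim_subseq strict_monoI)
       (auto intro: strict_monoD[OF N_sm])
  define u where "u x = c * lil_scale x / 2 + 1 + sqrt (e * x)" for x
  have ev: "eventually (\<lambda>k. inverse (2 * ln 2 + 2 * ln b * (real k + 1)) \<le> r k) sequentially"
    using eventually_compose_filterlim[OF lil_lower_asymptotics[OF c(1) e ce] NSuc_lim]
      eventually_compose_filterlim[OF central_binomial_eventually_ge m_lim]
      eventually_compose_filterlim[OF eventually_gt_at_top[of "exp 1"] NSuc_lim]
  proof eventually_elim
    case (elim k)
    let ?x = "real (N (Suc k))" and ?m = "real (m k)"
    have u: "4 * u ?x \<le> ?m" "(u ?x) ^ 2 / ?m + 8 * (u ?x) ^ 3 / ?m ^ 2 \<le> ln (ln ?x)"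
      using elim(1) by (auto simp: u_def me)
    have x0: "?x > 0" using elim(3) exp_gt_zero[of "1::real"] by linarith
    have lnx: "ln ?x > 1" using elim(3) x0 by (metis exp_less_cancel_iff exp_ln)
    have "1/2 * exp (- (u ?x ^ 2 / ?m) - 8 * u ?x ^ 3 / ?m ^ 2) \<le> r k"
      unfolding r_def
    proof (rule srw_tail_lower_bound[OF elim(2)])
      show "0 \<le> t (Suc k)"
        unfolding t_def lil_scale_def using c lnx x0 by simp
      show "m k \<ge> 1" using b by (simp add: m_def)
      show "t (Suc k) / 2 + 1 + sqrt ?m \<le> u ?x" by (simp add: t_def u_def me)
      show "4 * u ?x \<le> ?m" by (rule u)
    qed
    moreover have "exp (- ln (ln ?x)) \<le> exp (- (u ?x ^ 2 / ?m) - 8 * u ?x ^ 3 / ?m ^ 2)"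
      using u(2) by simp
    moreover have "exp (- ln (ln ?x)) = inverse (ln ?x)" using lnx by (simp add: exp_minus)
    ultimately have "1/2 * inverse (ln ?x) \<le> r k" by linarith
    moreover have "ln ?x = ln 2 + ln b * (real k + 1)"
    proof -
      have "?x = 2 * real b ^ Suc k" by (simp add: N_def)
      also have "ln \<dots> = ln 2 + real (Suc k) * ln b"
        using b by (subst ln_mult) (auto simp: ln_realpow ln_mult algebra_simps)
      finally show ?thesis by (simp add: algebra_simps)
    qed
    moreover have "inverse (2 * ln 2 + 2 * ln b * (real k + 1))
        = 1/2 * inverse (ln 2 + ln b * (real k + 1))"
      by (simp add: inverse_eq_divide algebra_simps flip: distrib_left)
    ultimately show ?case by simp
  qed
  have "\<not> summable r"
  proof
    assume s: "summable r"
    have lnb: "ln (real b) > 0" using b by simp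
    have "summable (\<lambda>k. inverse (2 * ln 2 + 2 * ln b * (real k + 1)))"
    proof (rule summable_comparison_test_ev[OF _ s])
      show "eventually (\<lambda>k. norm (inverse (2 * ln 2 + 2 * ln b * (real k + 1))) \<le> r k) sequentially"
        using ev by eventually_elim (use lnb in \<open>simp add: add_nonneg_nonneg\<close>)
    qed
    then have "summable (\<lambda>k. (2 * ln 2 + 2 * ln b) * inverse (2 * ln 2 + 2 * ln b * (real k + 1)))"
      by (rule summable_mult)
    moreover have le: "norm (inverse (real (Suc k)))
        \<le> (2 * ln 2 + 2 * ln b) * inverse (2 * ln 2 + 2 * ln b * (real k + 1))" for k
    proof -
      have pos: "0 < 2 * ln 2 + 2 * ln b * (real k + 1)"
        using lnb by (intro add_pos_nonneg mult_nonneg_nonneg) auto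
      have "2 * ln 2 + 2 * ln b * (real k + 1) \<le> (2 * ln 2 + 2 * ln b) * (real k + 1)"
        using lnb by (simp add: algebra_simps)
      then have "inverse ((2 * ln 2 + 2 * ln b) * (real k + 1))
          \<le> inverse (2 * ln 2 + 2 * ln b * (real k + 1))"
        by (rule le_imp_inverse_le[OF _ pos])
      moreover have C: "2 * ln 2 + 2 * ln b > 0" using lnb by (intro add_pos_pos) auto
      ultimately have "(2 * ln 2 + 2 * ln b) * inverse ((2 * ln 2 + 2 * ln b) * (real k + 1))
          \<le> (2 * ln 2 + 2 * ln b) * inverse (2 * ln 2 + 2 * ln b * (real k + 1))"
        by (intro mult_left_mono) auto
      moreover have "C * inverse (C * (real k + 1)) = norm (inverse (real (Suc k)))"
          if "C > 0" for C :: real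
        using that by (simp add: inverse_eq_divide add.commute)
      ultimately show ?thesis using C by (simp only:)
    qed
    ultimately have "summable (\<lambda>k. inverse (real (Suc k)))"
      by - (erule summable_comparison_test'[where N = 0], rule le)
    then show False
      using not_summable_harmonic[where 'a = real] summable_Suc_iff[of "\<lambda>k. inverse (real k)"] by simp
  qed
  then have "\<not> summable (\<lambda>k. (srw_op ^^ (2 * m k)) (far_indicator (t (Suc k))) 0)"
    unfolding r_def[abs_def] .
  moreover have "N k \<ge> 1" "even (N k)" for k using b by (auto simp: N_def)
  ultimately have "AE \<omega> in M. \<exists>\<^sub>\<infinity>k. t k \<le> \<bar>real_of_int (S (N k) \<omega>)\<bar>"
    by (intro infinitely_often_far[where N = N and m = m and t = t, OF p _ _ NSuc])
  then show ?thesis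
  proof eventually_elim
    case (elim \<omega>)
    show ?case unfolding INFM_nat_le
    proof
      fix n
      obtain k where "k \<ge> n" "t k \<le> \<bar>real_of_int (S (N k) \<omega>)\<bar>"
        using elim unfolding INFM_nat_le by blast
      moreover have "k \<le> N k" using N_sm by (rule strict_mono_imp_increasing)
      ultimately show "\<exists>j\<ge>n. c * lil_scale j \<le> \<bar>real_of_int (S j \<omega>)\<bar>"
        by (intro exI[of _ "N k"]) (auto simp: t_def)
    qed
  qed
qed

lemma lil_lower:
  assumes p: "p \<ge> 1/2"
  shows "AE \<omega> in M. 1 \<le> limsup (\<lambda>n. ereal (real_of_int \<bar>S n \<omega>\<bar> / sqrt (2 * real n * ln (ln (real n)))))"
proof -
  have "AE \<omega> in M. \<forall>i. \<exists>\<^sub>\<infinity>n. (1 - inverse (real (Suc (Suc i)))) * lil_scale n \<le> \<bar>real_of_int (S n \<omega>)\<bar>"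
    unfolding AE_all_countable
    by (intro allI lil_lower_infinitely_often[OF p]) (auto simp: inverse_eq_divide field_simps)
  then show ?thesis
  proof eventually_elim
    case (elim \<omega>)
    let ?X = "\<lambda>n. ereal (real_of_int \<bar>S n \<omega>\<bar> / sqrt (2 * real n * ln (ln (real n))))"
    have "ereal (1 - inverse (real (Suc (Suc i)))) \<le> limsup ?X" for i
    proof (rule ccontr)
      assume "\<not> ?thesis"
      then have "limsup ?X < ereal (1 - inverse (real (Suc (Suc i))))" by simp
      then have "eventually (\<lambda>n. ?X n < ereal (1 - inverse (real (Suc (Suc i))))) sequentially"
        by (rule Limsup_lessD)
      moreover have "eventually (\<lambda>n::nat. ln (ln (real n)) > 0) sequentially" by real_asymp
      moreover have "eventually (\<lambda>n::nat. real n > 0) sequentially" by real_asymp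
      ultimately have "eventually (\<lambda>n. \<not> (1 - inverse (real (Suc (Suc i)))) * lil_scale n
          \<le> \<bar>real_of_int (S n \<omega>)\<bar>) sequentially"
      proof eventually_elim
        case (elim n)
        then have "lil_scale n > 0" by (simp add: lil_scale_def)
        then show ?case using elim(1) by (simp add: lil_scale_def[symmetric] divide_less_eq)
      qed
      then show False using elim by (simp add: frequently_def cofinite_eq_sequentially)
    qed
    moreover have "(\<lambda>i. ereal (1 - inverse (real (Suc (Suc i))))) \<longlonglongrightarrow> ereal (1 - 0)"
      by (intro tendsto_intros LIMSEQ_Suc[OF LIMSEQ_inverse_real_of_nat])
    ultimately have "ereal (1 - 0) \<le> limsup ?X"
      by (intro LIMSEQ_le_const2) blast+
    then show "1 \<le> limsup ?X" by (simp add: one_ereal_def)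
  qed
qed

end

section \<open>The comparison with the simple random walk\<close>

theorem corollary1p10:
  fixes M :: "'a measure" and p :: real
    and \<sigma> :: "nat \<Rightarrow> 'a \<Rightarrow> int" and mem :: "nat \<Rightarrow> 'a \<Rightarrow> nat" and S :: "nat \<Rightarrow> 'a \<Rightarrow> int"
    and m :: nat
  assumes "elephant_random_walk M p \<sigma> mem S"
    and "m > 0"
  shows "(p \<le> 1/2 \<longrightarrow>
            recurrent M S
          \<and> expected_exit_time M S m \<ge> (of_nat m)\<^sup>2
          \<and> (AE \<omega> in M. limsup (\<lambda>n.
               ereal (real_of_int \<bar>S n \<omega>\<bar> / sqrt (2 * real n * ln (ln (real n))))) \<le> 1)
          \<and> liminf (\<lambda>n. ereal (sqrt (pi * real n) * \<P>(\<omega> in M. S (2 * n) \<omega> = 0))) \<ge> 1)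
       \<and> (p \<ge> 1/2 \<longrightarrow>
            expected_exit_time M S m \<le> (of_nat m)\<^sup>2
          \<and> (AE \<omega> in M. limsup (\<lambda>n.
               ereal (real_of_int \<bar>S n \<omega>\<bar> / sqrt (2 * real n * ln (ln (real n))))) \<ge> 1)
          \<and> limsup (\<lambda>n. ereal (sqrt (pi * real n) * \<P>(\<omega> in M. S (2 * n) \<omega> = 0))) \<le> 1)"
proof -
  interpret elephant_random_walk M p \<sigma> mem S by fact
  show ?thesis
    using recurrent_if_p_le_half expected_exit_time_ge[OF assms(2)] expected_exit_time_le[OF assms(2)]
      lil_upper lil_lower return_probability_liminf return_probability_limsup by blast
qed

end
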